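(* Let $L$ be an algebraic domain with a least element $\bot$ and a greatest element $\top$. Then the following are equivalent: (i) $L$ is not coherent; (ii) $L$ has as a Scott-retract either $\mathcal{K}(C)_\bot$ for some non-empty downward well-ordered chain $C$ without a least element, or $W(E)_\bot^\top$ for some infinite anti-chain $E$.
   Context: A dcpo is a poset in which every directed (non-empty, upward directed) subset has a supremum. In a dcpo $L$, $x\ll y$ means: for every directed $D\subseteq L$ with $y\le\sup D$ there is $d\in D$ with $x\le d$. An element $x$ is compact if $x\ll x$; $K(L)$ is the set of compact elements. $L$ is an algebraic domain if it is a dcpo and for every $x\in L$ the set $\{k\in K(L): k\le x\}$ is directed with supremum $x$. A subset $U\subseteq L$ is Scott open if it is an upper set and every directed $D\subseteq L$ with $\sup D\in U$ meets $U$; $\Sigma L$ is $L$ with the Scott topology. A map between dcpos is Scott-continuous if it is monotone and preserves suprema of directed sets (equivalently, continuous for the Scott topologies). A subset of a $T_0$ space is saturated if it is an upper set in the specialization order ($x\le y$ iff $x\in\mathrm{cl}(\{y\})$; for $\Sigma L$ this is the order of $L$). A topological space is coherent if the intersection of any two compact saturated subsets is compact; a dcpo $L$ is coherent if $\Sigma L$ is coherent. Compactness is in the open-cover sense (no separation assumed). A dcpo $M$ is a Scott-retract of a dcpo $L$ if there are Scott-continuous maps $s:M\to L$, $r:L\to M$ with $r\circ s=\mathrm{id}_M$. A chain $C$ is downward well-ordered if every non-empty subset of $C$ has a greatest element (i.e. $C^{op}$ is well-ordered). For such a $C$ without a least element, $\mathcal{K}(C)_\bot=C\cup\{a,b,\bot\}$,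 where $a,b$ are two incomparable new elements strictly below every element of $C$, $\bot$ is a new least element, and $C$ keeps its order. For an infinite anti-chain $E$ (distinct elements pairwise incomparable), $W(E)_\bot^\top=E\cup\{a,b,\bot,\top\}$, where $a,b$ are two incomparable new elements strictly below every element of $E$, $\bot$ is a new least element and $\top$ is a new greatest element. *)

theory Defs
  imports "HOL-Analysis.Analysis"
begin

(* A poset is a reflexive, transitive, antisymmetric relation r (Partial_order r of
   HOL.Order_Relation); its carrier is Field r, and (x, y) \<in> r means x \<le> y. *)

definition is_least :: "'a rel \<Rightarrow> 'a \<Rightarrow> bool" where
  "is_least r m \<longleftrightarrow> m \<in> Field r \<and> (\<forall>x\<in>Field r. (m, x) \<in> r)"

definition is_greatest :: "'a rel \<Rightarrow> 'a \<Rightarrow> bool" where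
  "is_greatest r m \<longleftrightarrow> m \<in> Field r \<and> (\<forall>x\<in>Field r. (x, m) \<in> r)"

definition is_sup :: "'a rel \<Rightarrow> 'a set \<Rightarrow> 'a \<Rightarrow> bool" where
  "is_sup r D s \<longleftrightarrow> s \<in> Above r D \<and> (\<forall>u\<in>Above r D. (s, u) \<in> r)"

definition directed_in :: "'a rel \<Rightarrow> 'a set \<Rightarrow> bool" where
  "directed_in r D \<longleftrightarrow>
     D \<subseteq> Field r \<and> D \<noteq> {} \<and> (\<forall>x\<in>D. \<forall>y\<in>D. \<exists>z\<in>D. (x, z) \<in> r \<and> (y, z) \<in> r)"

definition dcpo :: "'a rel \<Rightarrow> bool" where
  "dcpo r \<longleftrightarrow> Partial_order r \<and> (\<forall>D. directed_in r D \<longrightarrow> (\<exists>s. is_sup r D s))"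

definition way_below :: "'a rel \<Rightarrow> 'a \<Rightarrow> 'a \<Rightarrow> bool" where
  "way_below r x y \<longleftrightarrow> x \<in> Field r \<and> y \<in> Field r \<and>
     (\<forall>D s. directed_in r D \<and> is_sup r D s \<and> (y, s) \<in> r \<longrightarrow> (\<exists>d\<in>D. (x, d) \<in> r))"

definition compact_elements :: "'a rel \<Rightarrow> 'a set" where
  "compact_elements r = {x. way_below r x x}"

definition algebraic_domain :: "'a rel \<Rightarrow> bool" where
  "algebraic_domain r \<longleftrightarrow> dcpo r \<and>
     (\<forall>x\<in>Field r. directed_in r {k \<in> compact_elements r. (k, x) \<in> r} \<and>
                  is_sup r {k \<in> compact_elements r. (k, x) \<in> r} x)"

definition scott_open :: "'a rel \<Rightarrow> 'a set \<Rightarrow> bool" where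
  "scott_open r U \<longleftrightarrow> U \<subseteq> Field r \<and>
     (\<forall>x y. x \<in> U \<and> (x, y) \<in> r \<longrightarrow> y \<in> U) \<and>
     (\<forall>D s. directed_in r D \<and> is_sup r D s \<and> s \<in> U \<longrightarrow> D \<inter> U \<noteq> {})"

definition scott_topology :: "'a rel \<Rightarrow> 'a topology" where
  "scott_topology r = topology (scott_open r)"

lemma istopology_scott_open: "istopology (scott_open r)"
  unfolding istopology_def
proof (intro conjI allI impI)
  fix U V assume U: "scott_open r U" and V: "scott_open r V"
  note up = U[unfolded scott_open_def, THEN conjunct2, THEN conjunct1, rule_format]
    V[unfolded scott_open_def, THEN conjunct2, THEN conjunct1, rule_format]
  note meet = U[unfolded scott_open_def, THEN conjunct2, THEN conjunct2, rule_format]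
    V[unfolded scott_open_def, THEN conjunct2, THEN conjunct2, rule_format]
  show "scott_open r (U \<inter> V)"
    unfolding scott_open_def
  proof (intro conjI allI impI)
    show "U \<inter> V \<subseteq> Field r" using U by (auto simp: scott_open_def)
  next
    fix x y assume "x \<in> U \<inter> V \<and> (x, y) \<in> r"
    then show "y \<in> U \<inter> V" using up[of x y] by simp
  next
    fix D s assume D: "directed_in r D \<and> is_sup r D s \<and> s \<in> U \<inter> V"
    have "D \<inter> U \<noteq> {}" "D \<inter> V \<noteq> {}"
      using D meet[of D s] by simp_all
    then obtain d e where de: "d \<in> D" "d \<in> U" "e \<in> D" "e \<in> V" by blast
    then obtain z where "z \<in> D" "(d, z) \<in> r" "(e, z) \<in> r"
      using D unfolding directed_in_def by meson
    then show "D \<inter> (U \<inter> V) \<noteq> {}"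
      using up(1)[of d z] up(2)[of e z] de by auto
  qed
next
  fix \<U> assume \<U>: "\<forall>U\<in>\<U>. scott_open r U"
  show "scott_open r (\<Union>\<U>)"
    unfolding scott_open_def
  proof (intro conjI allI impI)
    show "\<Union>\<U> \<subseteq> Field r" using \<U> by (auto simp: scott_open_def)
  next
    fix x y assume xy: "x \<in> \<Union>\<U> \<and> (x, y) \<in> r"
    then obtain U where "U \<in> \<U>" "x \<in> U" by blast
    moreover from this have "scott_open r U" using \<U> by simp
    ultimately have "y \<in> U" using xy unfolding scott_open_def by meson
    then show "y \<in> \<Union>\<U>" using \<open>U \<in> \<U>\<close> by blast
  next
    fix D s assume D: "directed_in r D \<and> is_sup r D s \<and> s \<in> \<Union>\<U>"
    then obtain U where U: "U \<in> \<U>" "s \<in> U" by blast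
    then have "scott_open r U" using \<U> by simp
    then have "D \<inter> U \<noteq> {}" using D U unfolding scott_open_def by meson
    then show "D \<inter> \<Union>\<U> \<noteq> {}" using U by auto
  qed
qed

lemma openin_scott_topology [simp]: "openin (scott_topology r) = scott_open r"
  by (simp add: scott_topology_def istopology_scott_open)

lemma scott_open_Field: "scott_open r (Field r)"
  unfolding scott_open_def
proof (intro conjI allI impI)
  fix x y assume "x \<in> Field r \<and> (x, y) \<in> r"
  then show "y \<in> Field r" by (blast intro: FieldI2)
next
  fix D s assume "directed_in r D \<and> is_sup r D s \<and> s \<in> Field r"
  then show "D \<inter> Field r \<noteq> {}" by (simp add: directed_in_def Int_absorb2)
qed simp

lemma topspace_scott_topology [simp]: "topspace (scott_topology r) = Field r"
proof
  show "topspace (scott_topology r) \<subseteq> Field r"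
    by (auto simp: topspace_def scott_open_def)
  show "Field r \<subseteq> topspace (scott_topology r)"
    by (rule openin_subset) (simp add: scott_open_Field)
qed

(* Upper set in the specialization order, where x \<le> y iff x is in the closure of {y}. *)
definition saturated_in :: "'a topology \<Rightarrow> 'a set \<Rightarrow> bool" where
  "saturated_in X S \<longleftrightarrow> S \<subseteq> topspace X \<and>
     (\<forall>x\<in>S. \<forall>y\<in>topspace X. x \<in> X closure_of {y} \<longrightarrow> y \<in> S)"

lemma scott_specialization_order:
  assumes "Partial_order r" and "y \<in> Field r"
  shows "x \<in> scott_topology r closure_of {y} \<longleftrightarrow> (x, y) \<in> r"
proof
  assume x: "x \<in> scott_topology r closure_of {y}"
  have tr: "trans r" using assms(1) by (auto simp: order_on_defs)
  have yy: "(y, y) \<in> r" using assms by (auto simp: order_on_defs refl_on_def)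
  show "(x, y) \<in> r"
  proof (rule ccontr)
    assume n: "(x, y) \<notin> r"
    let ?U = "{z \<in> Field r. (z, y) \<notin> r}"
    have "scott_open r ?U"
      unfolding scott_open_def
    proof (intro conjI allI impI)
      fix u v assume "u \<in> ?U \<and> (u, v) \<in> r"
      then show "v \<in> ?U" using transD[OF tr, of u v y] FieldI2[of u v r] by simp blast
    next
      fix D s assume D: "directed_in r D \<and> is_sup r D s \<and> s \<in> ?U"
      show "D \<inter> ?U \<noteq> {}"
      proof
        assume "D \<inter> ?U = {}"
        then have "y \<in> Above r D"
          using D assms(2) by (auto simp: Above_def directed_in_def)
        then show False using D by (auto simp: is_sup_def)
      qed
    qed auto
    moreover have "x \<in> ?U" using x n by (simp add: in_closure_of)
    moreover have "y \<in> T" if "x \<in> T" "scott_open r T" for T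
      using x that by (auto simp: in_closure_of)
    ultimately have "y \<in> ?U" by metis
    then show False using yy by simp
  qed
next
  assume "(x, y) \<in> r"
  then show "x \<in> scott_topology r closure_of {y}"
    by (simp add: in_closure_of scott_open_def FieldI1) blast
qed

definition coherent_space :: "'a topology \<Rightarrow> bool" where
  "coherent_space X \<longleftrightarrow>
     (\<forall>A B. compactin X A \<and> saturated_in X A \<and> compactin X B \<and> saturated_in X B
            \<longrightarrow> compactin X (A \<inter> B))"

definition coherent_dcpo :: "'a rel \<Rightarrow> bool" where
  "coherent_dcpo r \<longleftrightarrow> coherent_space (scott_topology r)"

definition scott_continuous :: "'a rel \<Rightarrow> 'b rel \<Rightarrow> ('a \<Rightarrow> 'b) \<Rightarrow> bool" where
  "scott_continuous r q f \<longleftrightarrow> f \<in> Field r \<rightarrow> Field q \<and>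
     (\<forall>x y. (x, y) \<in> r \<longrightarrow> (f x, f y) \<in> q) \<and>
     (\<forall>D s. directed_in r D \<and> is_sup r D s \<longrightarrow> is_sup q (f ` D) (f s))"

definition scott_retract :: "'b rel \<Rightarrow> 'a rel \<Rightarrow> bool" where
  "scott_retract M L \<longleftrightarrow> dcpo M \<and> dcpo L \<and>
     (\<exists>s r. scott_continuous M L s \<and> scott_continuous L M r \<and> (\<forall>x\<in>Field M. r (s x) = x))"

definition downward_well_ordered_chain :: "'a rel \<Rightarrow> bool" where
  "downward_well_ordered_chain C \<longleftrightarrow> Linear_order C \<and>
     (\<forall>S. S \<subseteq> Field C \<and> S \<noteq> {} \<longrightarrow> (\<exists>g\<in>S. \<forall>x\<in>S. (x, g) \<in> C))"

definition is_antichain :: "'a rel \<Rightarrow> bool" where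
  "is_antichain E \<longleftrightarrow> Partial_order E \<and>
     (\<forall>x\<in>Field E. \<forall>y\<in>Field E. x \<noteq> y \<longrightarrow> (x, y) \<notin> E \<and> (y, x) \<notin> E)"

datatype 'c ext = Elem 'c | PtA | PtB | PtBot | PtTop

(* Carrier: the elements of P together with a, b and bottom; PtTop is not in the field. *)
definition K_bot :: "'c rel \<Rightarrow> 'c ext rel" where
  "K_bot P = {(Elem x, Elem y) | x y. (x, y) \<in> P}
     \<union> {PtA, PtB} \<times> Elem ` Field P
     \<union> {(PtA, PtA), (PtB, PtB)}
     \<union> {PtBot} \<times> (Elem ` Field P \<union> {PtA, PtB, PtBot})"

definition W_bot_top :: "'c rel \<Rightarrow> 'c ext rel" where
  "W_bot_top P = K_bot P \<union> (Elem ` Field P \<union> {PtA, PtB, PtBot, PtTop}) \<times> {PtTop}"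

(* The type argument fixes the type from which the carriers of C and E are taken,
   since HOL has no quantification over types inside a formula. *)
definition has_K_or_W_retract :: "'c itself \<Rightarrow> 'a rel \<Rightarrow> bool" where
  "has_K_or_W_retract (_ :: 'c itself) L \<longleftrightarrow>
     (\<exists>C :: 'c rel. downward_well_ordered_chain C \<and> Field C \<noteq> {} \<and>
        \<not> (\<exists>m. is_least C m) \<and> scott_retract (K_bot C) L) \<or>
     (\<exists>E :: 'c rel. is_antichain E \<and> infinite (Field E) \<and> scott_retract (W_bot_top E) L)"

end

(* By well-filteredness, an algebraic domain is coherent as soon as up a Int up b is compact for
   all compact elements a, b. If such an intersection U is not compact, then a and b are
   incomparable, and one of two things happens. Either U contains a chain without a lower bound in
   U; a coinitial dually well-ordered subset C of it gives the retract K(C). Or every element of U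
   lies above a minimal one; the minimal elements E of U are compact, infinitely many, and give the
   retract W(E), where a point goes to the unique member of E below it, if there is one, and to
   the top otherwise. Conversely, if s and r exhibit M as a retract of a coherent L, then
   up a Int up b in M is the r-image of the compact set up (s a) Int up (s b), whereas C in K(C)
   and E with the top element in W(E) are covered by the principal filters of their members
   without a finite subcover. *)

theory Submission
  imports Defs
begin

section \<open>Posets and Scott topology\<close>

lemma Partial_order_refl: "Partial_order r \<Longrightarrow> x \<in> Field r \<Longrightarrow> (x, x) \<in> r"
  by (auto simp: order_on_defs refl_on_def)

lemma Partial_order_trans: "Partial_order r \<Longrightarrow> (x, y) \<in> r \<Longrightarrow> (y, z) \<in> r \<Longrightarrow> (x, z) \<in> r"
  by (auto simp: order_on_defs dest: transD)

lemma Partial_order_antisym: "Partial_order r \<Longrightarrow> (x, y) \<in> r \<Longrightarrow> (y, x) \<in> r \<Longrightarrow> x = y"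
  by (auto simp: order_on_defs dest: antisymD)

lemma dcpo_Partial_order: "dcpo r \<Longrightarrow> Partial_order r"
  by (simp add: dcpo_def)

lemma algebraic_domain_Partial_order: "algebraic_domain r \<Longrightarrow> Partial_order r"
  by (simp add: algebraic_domain_def dcpo_def)

lemma is_sup_Field: "is_sup r D s \<Longrightarrow> s \<in> Field r"
  by (simp add: is_sup_def Above_def)

lemma is_sup_upper: "is_sup r D s \<Longrightarrow> d \<in> D \<Longrightarrow> (d, s) \<in> r"
  by (simp add: is_sup_def Above_def)

lemma is_sup_least:
  "is_sup r D s \<Longrightarrow> u \<in> Field r \<Longrightarrow> (\<And>d. d \<in> D \<Longrightarrow> (d, u) \<in> r) \<Longrightarrow> (s, u) \<in> r"
  by (simp add: is_sup_def Above_def)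

lemma scott_open_upper: "scott_open r U \<Longrightarrow> x \<in> U \<Longrightarrow> (x, y) \<in> r \<Longrightarrow> y \<in> U"
  unfolding scott_open_def by meson

lemma scott_open_meets:
  "scott_open r U \<Longrightarrow> directed_in r D \<Longrightarrow> is_sup r D s \<Longrightarrow> s \<in> U \<Longrightarrow> \<exists>d\<in>D. d \<in> U"
  unfolding scott_open_def by fast

lemma scott_open_Int: "scott_open r U \<Longrightarrow> scott_open r V \<Longrightarrow> scott_open r (U \<inter> V)"
  using istopology_scott_open[of r] by (simp add: istopology_def)

lemma scott_open_Union: "(\<And>U. U \<in> \<U> \<Longrightarrow> scott_open r U) \<Longrightarrow> scott_open r (\<Union>\<U>)"
  using istopology_scott_open[of r] by (simp add: istopology_def)

lemma scott_open_Un: "scott_open r U \<Longrightarrow> scott_open r V \<Longrightarrow> scott_open r (U \<union> V)"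
  using scott_open_Union[of "{U, V}" r] by auto

lemma saturated_in_scott_topology:
  assumes "Partial_order r"
  shows "saturated_in (scott_topology r) S \<longleftrightarrow> S \<subseteq> Field r \<and> (\<forall>x\<in>S. \<forall>y. (x, y) \<in> r \<longrightarrow> y \<in> S)"
  unfolding saturated_in_def
  using scott_specialization_order[OF assms] FieldI2[of _ _ r] by (simp, blast)

section \<open>Upper sets and principal filters\<close>

definition up :: "'a rel \<Rightarrow> 'a set \<Rightarrow> 'a set" where
  "up r F = {y. \<exists>x\<in>F. (x, y) \<in> r}"

lemma up_subset_Field: "up r F \<subseteq> Field r"
  by (auto simp: up_def intro: FieldI2)

lemma up_upper: "Partial_order r \<Longrightarrow> x \<in> up r F \<Longrightarrow> (x, y) \<in> r \<Longrightarrow> y \<in> up r F"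
  by (auto simp: up_def intro: Partial_order_trans)

lemma saturated_up: "Partial_order r \<Longrightarrow> saturated_in (scott_topology r) (up r F)"
  using up_upper up_subset_Field by (metis saturated_in_scott_topology)

text \<open>An open set containing \<open>x\<close> contains the whole filter, so a single member of
  a cover suffices.\<close>

lemma compactin_up_singleton:
  assumes "Partial_order r" "x \<in> Field r"
  shows "compactin (scott_topology r) (up r {x})"
  unfolding compactin_def
proof (intro conjI allI impI)
  show "up r {x} \<subseteq> topspace (scott_topology r)" by (simp add: up_subset_Field)
  fix \<U> assume \<U>: "Ball \<U> (openin (scott_topology r)) \<and> up r {x} \<subseteq> \<Union> \<U>"
  have "x \<in> up r {x}" using Partial_order_refl[OF assms] by (simp add: up_def)
  then obtain U where U: "U \<in> \<U>" "x \<in> U" using \<U> by blast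
  then have "up r {x} \<subseteq> U"
    using \<U> scott_open_upper[of r U x] by (auto simp: up_def)
  then show "\<exists>\<F>. finite \<F> \<and> \<F> \<subseteq> \<U> \<and> up r {x} \<subseteq> \<Union> \<F>"
    using U by (intro exI[of _ "{U}"]) auto
qed

text \<open>Induction on finite subsets of \<open>D\<close>, with the bounds chosen in
  \<open>D\<close>. It later settles the directed sets inside
  \<open>{PtA, PtB, PtBot}\<close>.\<close>

lemma finite_directed_has_greatest:
  assumes "Partial_order r" "directed_in r D" "finite D"
  shows "\<exists>m\<in>D. \<forall>d\<in>D. (d, m) \<in> r"
proof -
  have "\<exists>m\<in>D. \<forall>d\<in>F. (d, m) \<in> r" if "finite F" "F \<subseteq> D" for F
    using that
  proof (induction F rule: finite_induct)
    case empty
    then show ?case using assms(2) by (auto simp: directed_in_def)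
  next
    case (insert x F)
    then obtain m where m: "m \<in> D" "\<forall>d\<in>F. (d, m) \<in> r" by blast
    then obtain z where "z \<in> D" "(x, z) \<in> r" "(m, z) \<in> r"
      using insert.prems assms(2) unfolding directed_in_def by blast
    then show ?case using m Partial_order_trans[OF assms(1)] by blast
  qed
  then show ?thesis using assms(3) by blast
qed

text \<open>A monotone map sends directed sets to directed sets, so preservation of suprema makes
  preimages of open sets open. Compactness can then be pushed forward along a retraction.\<close>

lemma continuous_map_scott:
  assumes "scott_continuous r q f"
  shows "continuous_map (scott_topology r) (scott_topology q) f"
  unfolding continuous_map_def
proof (intro conjI allI impI)
  have fF: "f \<in> Field r \<rightarrow> Field q" and
    mono: "\<And>x y. (x, y) \<in> r \<Longrightarrow> (f x, f y) \<in> q" and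
    sup: "\<And>D s. directed_in r D \<Longrightarrow> is_sup r D s \<Longrightarrow> is_sup q (f ` D) (f s)"
    using assms by (auto simp: scott_continuous_def)
  show "f \<in> topspace (scott_topology r) \<rightarrow> topspace (scott_topology q)" using fF by simp
  fix U assume "openin (scott_topology q) U"
  then have U: "scott_open q U" by simp
  have "scott_open r {x \<in> Field r. f x \<in> U}"
    unfolding scott_open_def
  proof (intro conjI allI impI)
    fix x y assume "x \<in> {x \<in> Field r. f x \<in> U} \<and> (x, y) \<in> r"
    then show "y \<in> {x \<in> Field r. f x \<in> U}"
      using mono scott_open_upper[OF U] by (auto intro: FieldI2)
  next
    fix D s assume D: "directed_in r D \<and> is_sup r D s \<and> s \<in> {x \<in> Field r. f x \<in> U}"
    have "directed_in q (f ` D)"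
      unfolding directed_in_def
    proof (intro conjI ballI)
      show "f ` D \<subseteq> Field q" "f ` D \<noteq> {}" using D fF by (auto simp: directed_in_def)
      fix u v assume "u \<in> f ` D" "v \<in> f ` D"
      then obtain x y where xy: "x \<in> D" "y \<in> D" "u = f x" "v = f y" by blast
      then obtain z where "z \<in> D" "(x, z) \<in> r" "(y, z) \<in> r"
        using D unfolding directed_in_def by blast
      then show "\<exists>w\<in>f ` D. (u, w) \<in> q \<and> (v, w) \<in> q" using mono xy(3,4) by blast
    qed
    moreover have "is_sup q (f ` D) (f s)" "f s \<in> U" using D sup by auto
    ultimately have "\<exists>u\<in>f ` D. u \<in> U" by (rule scott_open_meets[OF U])
    then show "D \<inter> {x \<in> Field r. f x \<in> U} \<noteq> {}"
      using D by (auto simp: directed_in_def)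
  qed auto
  then show "openin (scott_topology r) {x \<in> topspace (scott_topology r). f x \<in> U}" by simp
qed

section \<open>Algebraic domains\<close>

lemma compact_elements_Field: "k \<in> compact_elements r \<Longrightarrow> k \<in> Field r"
  by (simp add: compact_elements_def way_below_def)

lemma compact_elementD:
  "k \<in> compact_elements r \<Longrightarrow> directed_in r D \<Longrightarrow> is_sup r D s \<Longrightarrow> (k, s) \<in> r \<Longrightarrow> \<exists>d\<in>D. (k, d) \<in> r"
  unfolding compact_elements_def way_below_def by blast

text \<open>Compactness of a generator \<open>k\<close> says that a directed set with supremum above
  \<open>k\<close> already has a member above \<open>k\<close>.\<close>

lemma scott_open_up:
  assumes "Partial_order r" "F \<subseteq> compact_elements r"
  shows "scott_open r (up r F)"
  unfolding scott_open_def
proof (intro conjI allI impI)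
  fix D s assume D: "directed_in r D \<and> is_sup r D s \<and> s \<in> up r F"
  then obtain k where k: "k \<in> F" "(k, s) \<in> r" by (auto simp: up_def)
  then obtain d where "d \<in> D" "(k, d) \<in> r" using compact_elementD[of k r D s] D assms by blast
  then show "D \<inter> up r F \<noteq> {}" using k by (auto simp: up_def)
qed (use up_subset_Field[of r] up_upper[OF assms(1)] in auto)

lemma algebraic_approx:
  assumes "algebraic_domain r" "x \<in> Field r"
  shows "directed_in r {k \<in> compact_elements r. (k, x) \<in> r}"
    and "is_sup r {k \<in> compact_elements r. (k, x) \<in> r} x"
  using assms by (auto simp: algebraic_domain_def)

text \<open>A point is the directed supremum of the compact elements below it, so an open set around
  it contains one of them. Hence the principal filters of compact elements form a base.\<close>

lemma compact_in_open_below: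
  assumes "algebraic_domain r" "scott_open r U" "x \<in> U"
  shows "\<exists>k\<in>compact_elements r. (k, x) \<in> r \<and> k \<in> U"
proof -
  have "x \<in> Field r" using assms by (auto simp: scott_open_def)
  then show ?thesis
    using algebraic_approx[OF assms(1)] scott_open_meets[OF assms(2)] assms(3) by blast
qed

text \<open>The filters of the compact elements in \<open>U\<close> cover \<open>A\<close>; the
  generators of a finite subcover form \<open>F\<close>.\<close>

lemma compactin_subset_up:
  assumes alg: "algebraic_domain r" and A: "compactin (scott_topology r) A"
    and U: "scott_open r U" and AU: "A \<subseteq> U"
  shows "\<exists>F. finite F \<and> F \<subseteq> compact_elements r \<and> F \<subseteq> U \<and> A \<subseteq> up r F"
proof -
  note po = algebraic_domain_Partial_order[OF alg]
  define K where "K = compact_elements r \<inter> U"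
  let ?\<U> = "(\<lambda>k. up r {k}) ` K"
  have "Ball ?\<U> (openin (scott_topology r))"
    using scott_open_up[OF po] by (auto simp: K_def)
  moreover have "A \<subseteq> \<Union> ?\<U>"
    using compact_in_open_below[OF alg U] AU unfolding up_def K_def by fastforce
  ultimately obtain \<F> where \<F>: "finite \<F>" "\<F> \<subseteq> ?\<U>" "A \<subseteq> \<Union>\<F>"
    using A unfolding compactin_def by meson
  then obtain F where "finite F" "F \<subseteq> K" "\<F> = (\<lambda>k. up r {k}) ` F"
    by (meson finite_subset_image)
  then show ?thesis using \<F>(3) by (intro exI[of _ F]) (auto simp: up_def K_def)
qed

text \<open>Well-filteredness. An open set that is maximal among those containing no member of
  \<open>\<K>\<close> has a complement whose compact elements are directed; their supremum lies in
  every member of \<open>\<K>\<close>.\<close>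

lemma algebraic_domain_well_filtered:
  assumes alg: "algebraic_domain r" and ne: "\<K> \<noteq> {}"
    and cpt: "\<And>Q. Q \<in> \<K> \<Longrightarrow> compactin (scott_topology r) Q"
    and sat: "\<And>Q. Q \<in> \<K> \<Longrightarrow> saturated_in (scott_topology r) Q"
    and filt: "\<And>P Q. P \<in> \<K> \<Longrightarrow> Q \<in> \<K> \<Longrightarrow> \<exists>R\<in>\<K>. R \<subseteq> P \<inter> Q"
    and V: "scott_open r V" and sub: "\<Inter>\<K> \<subseteq> V"
  shows "\<exists>Q\<in>\<K>. Q \<subseteq> V"
proof (rule ccontr)
  assume neg: "\<not> (\<exists>Q\<in>\<K>. Q \<subseteq> V)"
  note po = algebraic_domain_Partial_order[OF alg]
  let ?\<O> = "{W. scott_open r W \<and> V \<subseteq> W \<and> (\<forall>Q\<in>\<K>. \<not> Q \<subseteq> W)}"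
  have "\<exists>M\<in>?\<O>. \<forall>X\<in>?\<O>. M \<subseteq> X \<longrightarrow> X = M"
  proof (rule subset_Zorn_nonempty)
    show "?\<O> \<noteq> {}" using V neg by blast
  next
    fix \<C> assume C: "\<C> \<noteq> {}" "subset.chain ?\<O> \<C>"
    then have CO: "\<C> \<subseteq> ?\<O>" by (simp add: subset.chain_def)
    \<comment> \<open>This is where compactness enters: if the union covered \<open>Q\<close>,
      finitely many members of the chain would, and these lie in a single member.\<close>
    have "\<not> Q \<subseteq> \<Union>\<C>" if Q: "Q \<in> \<K>" for Q
    proof
      assume "Q \<subseteq> \<Union>\<C>"
      moreover have "Ball \<C> (openin (scott_topology r))" using CO by auto
      ultimately obtain \<F> where \<F>: "finite \<F>" "\<F> \<subseteq> \<C>" "Q \<subseteq> \<Union>\<F>"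
        using cpt[OF Q] unfolding compactin_def by meson
      have "\<exists>W\<in>\<C>. \<Union>\<F> \<subseteq> W"
      proof (cases "\<F> = {}")
        case True
        then show ?thesis using C(1) by auto
      next
        case False
        have "subset.chain ?\<O> \<F>" using C(2) \<F>(2) unfolding subset.chain_def by (meson subset_trans subsetD)
        then show ?thesis using Union_in_chain \<F> False by blast
      qed
      then obtain W where "W \<in> \<C>" "Q \<subseteq> W" using \<F>(3) by (meson subset_trans)
      moreover from this have "W \<in> ?\<O>" using CO by (meson subsetD)
      ultimately show False using Q by simp
    qed
    then show "\<Union>\<C> \<in> ?\<O>" using CO C(1) scott_open_Union[of \<C> r] by auto
  qed
  then obtain W where WO: "W \<in> ?\<O>" and WM: "\<forall>X\<in>?\<O>. W \<subseteq> X \<longrightarrow> X = W" by meson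
  have W: "scott_open r W" "V \<subseteq> W" "\<And>Q. Q \<in> \<K> \<Longrightarrow> \<not> Q \<subseteq> W" using WO by simp_all
  have max: "\<exists>Q\<in>\<K>. Q \<subseteq> X" if X: "scott_open r X" "W \<subset> X" for X
  proof (rule ccontr)
    assume "\<not> (\<exists>Q\<in>\<K>. Q \<subseteq> X)"
    then have "X \<in> ?\<O>" using X W(2) by auto
    then have "X = W" using WM X(2) by (meson psubset_imp_subset)
    then show False using X(2) by simp
  qed
  define D where "D = compact_elements r - W"
  have below: "k \<in> D" if "k \<in> compact_elements r" "(k, z) \<in> r" "z \<notin> W" for k z
    using that scott_open_upper[OF W(1)] by (auto simp: D_def)
  have KF: "z \<in> Field r" if "Q \<in> \<K>" "z \<in> Q" for Q z
    using cpt[OF that(1)] that(2) by (auto simp: compactin_def)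
  have dir: "directed_in r D"
    unfolding directed_in_def
  proof (intro conjI ballI)
    show "D \<subseteq> Field r" using compact_elements_Field by (auto simp: D_def)
    obtain Q z where "Q \<in> \<K>" "z \<in> Q" "z \<notin> W" using ne W(3) by blast
    then show "D \<noteq> {}"
      using algebraic_approx(1)[OF alg KF] below unfolding directed_in_def by blast
  next
    have step: "\<exists>Q\<in>\<K>. Q \<subseteq> W \<union> up r {k}" if k: "k \<in> D" for k
    proof (rule max)
      show "scott_open r (W \<union> up r {k})"
        using k W(1) scott_open_up[OF po] by (auto simp: D_def intro!: scott_open_Un)
      have "k \<in> up r {k}"
        using k Partial_order_refl[OF po compact_elements_Field[of k]] by (simp add: D_def up_def)
      then show "W \<subset> W \<union> up r {k}" using k by (auto simp: D_def)
    qed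
    fix k l assume kl: "k \<in> D" "l \<in> D"
    obtain P Q where PQ: "P \<in> \<K>" "P \<subseteq> W \<union> up r {k}" "Q \<in> \<K>" "Q \<subseteq> W \<union> up r {l}"
      using step kl by meson
    \<comment> \<open>A point \<open>z\<close> of \<open>R\<close> outside \<open>W\<close> must lie
      above both \<open>k\<close> and \<open>l\<close>. The compact elements below \<open>z\<close>
      are directed, and they stay outside \<open>W\<close> because \<open>W\<close> is an upper
      set.\<close>
    then obtain R where R: "R \<in> \<K>" "R \<subseteq> P \<inter> Q" using filt by meson
    then obtain z where z: "z \<in> R" "z \<notin> W" using W(3) by blast
    then have zkl: "(k, z) \<in> r" "(l, z) \<in> r" using R PQ by (auto simp: up_def)
    have "z \<in> Field r" using KF R(1) z(1) by blast
    then have "directed_in r {k \<in> compact_elements r. (k, z) \<in> r}"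
      by (rule algebraic_approx(1)[OF alg])
    moreover have "k \<in> compact_elements r" "l \<in> compact_elements r"
      using kl by (auto simp: D_def)
    ultimately obtain m where
      "m \<in> compact_elements r" "(m, z) \<in> r" "(k, m) \<in> r" "(l, m) \<in> r"
      using zkl unfolding directed_in_def by blast
    then show "\<exists>m\<in>D. (k, m) \<in> r \<and> (l, m) \<in> r" using below z(2) by blast
  qed
  then obtain x where x: "is_sup r D x" using alg unfolding algebraic_domain_def dcpo_def by blast
  have "x \<notin> W" using scott_open_meets[OF W(1) dir x] by (auto simp: D_def)
  moreover have "x \<in> Q" if Q: "Q \<in> \<K>" for Q
  proof -
    \<comment> \<open>All compact elements below \<open>z\<close> belong to \<open>D\<close>, so
      \<open>z\<close>, their supremum, is below \<open>x\<close>; saturation then puts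
      \<open>x\<close> into \<open>Q\<close>.\<close>
    obtain z where z: "z \<in> Q" "z \<notin> W" using W(3)[OF Q] by blast
    have "(z, x) \<in> r"
      using algebraic_approx(2)[OF alg KF[OF Q z(1)]] is_sup_Field[OF x]
    proof (rule is_sup_least)
      fix k assume "k \<in> {k \<in> compact_elements r. (k, z) \<in> r}"
      then show "(k, x) \<in> r" using below z(2) is_sup_upper[OF x] by blast
    qed
    then show ?thesis using sat[OF Q] z(1) by (auto simp: saturated_in_scott_topology[OF po])
  qed
  ultimately show False using sub W(2) by blast
qed

text \<open>A compact saturated set is the filtered intersection of its neighbourhoods
  \<open>up r F\<close> with \<open>F\<close> a finite set of compact elements. Thus
  \<open>A \<inter> B\<close> is the filtered intersection of sets
  \<open>up r F \<inter> up r G\<close>, each a finite union of sets compact by hypothesis. By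
  well-filteredness, an open cover of \<open>A \<inter> B\<close> covers one of them.\<close>

lemma coherent_dcpo_if_compact_up_Int:
  assumes alg: "algebraic_domain r"
    and cpt: "\<And>a b. a \<in> compact_elements r \<Longrightarrow> b \<in> compact_elements r \<Longrightarrow>
      compactin (scott_topology r) (up r {a} \<inter> up r {b})"
  shows "coherent_dcpo r"
  unfolding coherent_dcpo_def coherent_space_def
proof (intro allI impI, elim conjE)
  note po = algebraic_domain_Partial_order[OF alg]
  let ?X = "scott_topology r"
  fix A B
  assume A: "compactin ?X A" "saturated_in ?X A" and B: "compactin ?X B" "saturated_in ?X B"
  have satA: "A \<subseteq> Field r" "\<And>x y. x \<in> A \<Longrightarrow> (x, y) \<in> r \<Longrightarrow> y \<in> A"
    and satB: "B \<subseteq> Field r" "\<And>x y. x \<in> B \<Longrightarrow> (x, y) \<in> r \<Longrightarrow> y \<in> B"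
    using A(2) B(2) by (auto simp: saturated_in_scott_topology[OF po])
  define N where "N S = {F. finite F \<and> F \<subseteq> compact_elements r \<and> S \<subseteq> up r F}" for S
  define \<K> where "\<K> = {up r F \<inter> up r G |F G. F \<in> N A \<and> G \<in> N B}"
  have N_ex: "\<exists>F\<in>N S. F \<subseteq> U" if "compactin ?X S" "scott_open r U" "S \<subseteq> U" for S U
    using compactin_subset_up[OF alg that] by (auto simp: N_def)
  have N_open: "scott_open r (up r F)" if "F \<in> N S" for F S
    using scott_open_up[OF po] that by (auto simp: N_def)
  have up_sub: "up r F \<subseteq> U" if "F \<subseteq> U" "scott_open r U" for F U
    using that scott_open_upper[OF that(2)] by (auto simp: up_def)
  have N_filt: "\<exists>H\<in>N S. up r H \<subseteq> up r F \<inter> up r G"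
    if S: "compactin ?X S" and FG: "F \<in> N S" "G \<in> N S" for S F G
  proof -
    have o: "scott_open r (up r F \<inter> up r G)" using FG N_open scott_open_Int by meson
    moreover have "S \<subseteq> up r F \<inter> up r G" using FG by (auto simp: N_def)
    ultimately show ?thesis using N_ex[OF S] up_sub by meson
  qed
  \<comment> \<open>The complement of the lower set of \<open>x\<close> is an open neighbourhood of
    \<open>S\<close>, so some \<open>F\<close> can be chosen inside it.\<close>
  have N_sep: "\<exists>F\<in>N S. x \<notin> up r F"
    if S: "compactin ?X S" and x: "x \<in> Field r" and ax: "\<And>y. y \<in> S \<Longrightarrow> (y, x) \<notin> r" for S x
  proof -
    have SF: "S \<subseteq> Field r" using S by (auto simp: compactin_def)
    let ?U = "{y \<in> Field r. (y, x) \<notin> r}"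
    have "scott_open r ?U"
      unfolding scott_open_def
    proof (intro conjI allI impI)
      fix u v assume "u \<in> ?U \<and> (u, v) \<in> r"
      then show "v \<in> ?U" using Partial_order_trans[OF po] by (auto intro: FieldI2)
    next
      fix D s assume "directed_in r D \<and> is_sup r D s \<and> s \<in> ?U"
      then show "D \<inter> ?U \<noteq> {}"
        using is_sup_least[of r D s x] x by (auto simp: directed_in_def)
    qed auto
    then obtain F where "F \<in> N S" "F \<subseteq> ?U" using N_ex[OF S, of ?U] ax SF by blast
    then show ?thesis by (auto simp: up_def)
  qed
  show "compactin ?X (A \<inter> B)"
    unfolding compactin_def
  proof (intro conjI allI impI)
    show "A \<inter> B \<subseteq> topspace ?X" using satA by auto
    fix \<U> assume \<U>: "Ball \<U> (openin ?X) \<and> A \<inter> B \<subseteq> \<Union>\<U>"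
    have cK: "compactin ?X Q" if "Q \<in> \<K>" for Q
    proof -
      obtain F G where FG: "Q = up r F \<inter> up r G" "F \<in> N A" "G \<in> N B"
        using \<open>Q \<in> \<K>\<close> by (auto simp: \<K>_def)
      have "compactin ?X (\<Union>((\<lambda>(f, g). up r {f} \<inter> up r {g}) ` (F \<times> G)))"
        using FG(2,3) cpt by (intro compactin_Union) (auto simp: N_def subset_iff)
      moreover have "\<Union>((\<lambda>(f, g). up r {f} \<inter> up r {g}) ` (F \<times> G)) = Q"
        by (auto simp: FG(1) up_def)
      ultimately show ?thesis by simp
    qed
    have "\<exists>Q\<in>\<K>. Q \<subseteq> \<Union>\<U>"
    proof (rule algebraic_domain_well_filtered[OF alg _ cK])
      show "\<K> \<noteq> {}"
        using N_ex[OF A(1) scott_open_Field satA(1)] N_ex[OF B(1) scott_open_Field satB(1)]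
        by (auto simp: \<K>_def)
    next
      fix Q assume "Q \<in> \<K>"
      then show "saturated_in ?X Q"
        using up_upper[OF po] up_subset_Field[of r]
        by (auto simp: \<K>_def saturated_in_scott_topology[OF po]) blast+
    next
      fix P Q assume "P \<in> \<K>" "Q \<in> \<K>"
      then obtain F G F' G' where FG: "F \<in> N A" "G \<in> N B" "F' \<in> N A" "G' \<in> N B"
        and eq: "P = up r F \<inter> up r G" "Q = up r F' \<inter> up r G'"
        by (auto simp: \<K>_def)
      obtain H H' where "H \<in> N A" "up r H \<subseteq> up r F \<inter> up r F'"
        "H' \<in> N B" "up r H' \<subseteq> up r G \<inter> up r G'"
        using N_filt[OF A(1) FG(1,3)] N_filt[OF B(1) FG(2,4)] by blast
      then show "\<exists>R\<in>\<K>. R \<subseteq> P \<inter> Q"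
        by (intro bexI[of _ "up r H \<inter> up r H'"]) (auto simp: eq \<K>_def)
    next
      show "scott_open r (\<Union>\<U>)" using \<U> by (auto intro: scott_open_Union)
    next
      have "x \<in> A \<inter> B" if x: "x \<in> \<Inter>\<K>" for x
      proof -
        \<comment> \<open>Members of \<open>\<K>\<close> involve both sets at once. Pairing with a
          fixed neighbourhood of the other set shows that \<open>x\<close> lies in every
          neighbourhood of \<open>A\<close>, and likewise of \<open>B\<close>.\<close>
        obtain F\<^sub>0 G\<^sub>0 where FG0: "F\<^sub>0 \<in> N A" "G\<^sub>0 \<in> N B"
          using N_ex[OF A(1) scott_open_Field satA(1)] N_ex[OF B(1) scott_open_Field satB(1)]
          by blast
        have in_up: "x \<in> up r F \<inter> up r G" if "F \<in> N A" "G \<in> N B" for F G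
          using x that by (auto simp: \<K>_def)
        then have "x \<in> Field r" using FG0 up_subset_Field[of r] by blast
        then show ?thesis
          using in_up FG0 N_sep[OF A(1)] N_sep[OF B(1)] satA(2) satB(2) by blast
      qed
      then show "\<Inter>\<K> \<subseteq> \<Union>\<U>" using \<U> by blast
    qed
    then obtain Q where Q: "Q \<in> \<K>" "Q \<subseteq> \<Union>\<U>" by blast
    then obtain \<F> where "finite \<F>" "\<F> \<subseteq> \<U>" "Q \<subseteq> \<Union>\<F>"
      using cK[OF Q(1)] \<U> unfolding compactin_def by meson
    moreover have "A \<inter> B \<subseteq> Q" using Q(1) by (auto simp: \<K>_def N_def)
    ultimately show "\<exists>\<F>. finite \<F> \<and> \<F> \<subseteq> \<U> \<and> A \<inter> B \<subseteq> \<Union>\<F>" by blast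
  qed
qed

section \<open>Posets in which directed suprema are attained\<close>

text \<open>The ascending chain condition in directed form. All elements of such a poset are
  compact, and its Scott open sets are exactly the upper sets. Both model posets are of this
  kind.\<close>

definition directed_attained :: "'a rel \<Rightarrow> bool" where
  "directed_attained r \<longleftrightarrow> Partial_order r \<and>
     (\<forall>D. directed_in r D \<longrightarrow> (\<exists>m\<in>D. \<forall>d\<in>D. (d, m) \<in> r))"

lemma is_sup_greatest:
  "m \<in> D \<Longrightarrow> D \<subseteq> Field r \<Longrightarrow> \<forall>d\<in>D. (d, m) \<in> r \<Longrightarrow> is_sup r D m"
  by (auto simp: is_sup_def Above_def)

lemma is_sup_unique: "Partial_order r \<Longrightarrow> is_sup r D s \<Longrightarrow> is_sup r D t \<Longrightarrow> s = t"
  by (rule Partial_order_antisym) (auto simp: is_sup_def)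

lemma directed_attained_sup:
  assumes "directed_attained r" "directed_in r D" "is_sup r D s"
  shows "s \<in> D"
proof -
  obtain m where m: "m \<in> D" "\<forall>d\<in>D. (d, m) \<in> r" using assms by (auto simp: directed_attained_def)
  then have "is_sup r D m" using assms(2) by (intro is_sup_greatest) (auto simp: directed_in_def)
  then show ?thesis
    using is_sup_unique[OF _ assms(3)] assms(1) m(1) by (auto simp: directed_attained_def)
qed

lemma directed_attained_dcpo: "directed_attained r \<Longrightarrow> dcpo r"
  unfolding directed_attained_def dcpo_def using is_sup_greatest
  by (metis directed_in_def)

lemma scott_open_up_attained:
  assumes "directed_attained r" shows "scott_open r (up r F)"
  unfolding scott_open_def
proof (intro conjI allI impI)
  have po: "Partial_order r" using assms by (simp add: directed_attained_def)
  show "up r F \<subseteq> Field r" by (rule up_subset_Field)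
  show "y \<in> up r F" if "x \<in> up r F \<and> (x, y) \<in> r" for x y
    using that up_upper[OF po] by blast
  show "D \<inter> up r F \<noteq> {}" if "directed_in r D \<and> is_sup r D s \<and> s \<in> up r F" for D s
    using that directed_attained_sup[OF assms] by blast
qed

text \<open>Monotonicity suffices: the supremum \<open>s\<close> lies in \<open>D\<close>, so
  \<open>f s\<close> is the greatest element of the image. This handles the sections.\<close>

lemma scott_continuous_from_attained:
  assumes "directed_attained r" and "\<And>x y. (x, y) \<in> r \<Longrightarrow> (f x, f y) \<in> q"
  shows "scott_continuous r q f"
  unfolding scott_continuous_def
proof (intro conjI allI impI)
  have po: "Partial_order r" using assms by (simp add: directed_attained_def)
  show F: "f \<in> Field r \<rightarrow> Field q"
    using assms(2) Partial_order_refl[OF po] by (blast intro: FieldI1)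
  show "(f x, f y) \<in> q" if "(x, y) \<in> r" for x y using that by (rule assms(2))
  show "is_sup q (f ` D) (f s)" if D: "directed_in r D \<and> is_sup r D s" for D s
  proof (rule is_sup_greatest)
    show "f s \<in> f ` D" using D directed_attained_sup[OF assms(1)] by blast
    show "f ` D \<subseteq> Field q" using F D by (auto simp: directed_in_def)
    show "\<forall>d\<in>f ` D. (d, f s) \<in> q" using D is_sup_upper assms(2) by fast
  qed
qed

text \<open>By monotonicity and antisymmetry, \<open>att\<close> makes \<open>f s\<close> the
  greatest element of the image. This handles the retractions, whose targets have attained
  suprema.\<close>

lemma scott_continuous_if_attained:
  assumes "Partial_order r" "Partial_order q"
    and mono: "\<And>x y. (x, y) \<in> r \<Longrightarrow> (f x, f y) \<in> q"
    and att: "\<And>D s. directed_in r D \<Longrightarrow> is_sup r D s \<Longrightarrow> \<exists>d\<in>D. (f s, f d) \<in> q"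
  shows "scott_continuous r q f"
  unfolding scott_continuous_def
proof (intro conjI allI impI)
  show F: "f \<in> Field r \<rightarrow> Field q"
    using mono Partial_order_refl[OF assms(1)] by (blast intro: FieldI1)
  show "(f x, f y) \<in> q" if "(x, y) \<in> r" for x y using that by (rule mono)
  show "is_sup q (f ` D) (f s)" if D: "directed_in r D \<and> is_sup r D s" for D s
  proof -
    obtain d where d: "d \<in> D" "(f s, f d) \<in> q" using att D by blast
    have up: "(f e, f s) \<in> q" if "e \<in> D" for e using that D is_sup_upper mono by fast
    have "f s = f d" using up d Partial_order_antisym[OF assms(2)] by blast
    then show ?thesis
      using d(1) up F D by (intro is_sup_greatest) (auto simp: directed_in_def)
  qed
qed

section \<open>The posets \<open>K_bot\<close> and \<open>W_bot_top\<close>\<close>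

lemma K_bot_simps [simp]:
  "(Elem x, Elem y) \<in> K_bot P \<longleftrightarrow> (x, y) \<in> P"
  "(PtA, Elem y) \<in> K_bot P \<longleftrightarrow> y \<in> Field P"
  "(PtB, Elem y) \<in> K_bot P \<longleftrightarrow> y \<in> Field P"
  "(PtBot, Elem y) \<in> K_bot P \<longleftrightarrow> y \<in> Field P"
  "(u, PtA) \<in> K_bot P \<longleftrightarrow> u = PtA \<or> u = PtBot"
  "(u, PtB) \<in> K_bot P \<longleftrightarrow> u = PtB \<or> u = PtBot"
  "(u, PtBot) \<in> K_bot P \<longleftrightarrow> u = PtBot"
  "(u, PtTop) \<notin> K_bot P"
  "(PtTop, u) \<notin> K_bot P"
  by (auto simp: K_bot_def)

lemma W_bot_top_simps [simp]:
  "(u, PtTop) \<in> W_bot_top P \<longleftrightarrow> u \<in> Elem ` Field P \<union> {PtA, PtB, PtBot, PtTop}"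
  "v \<noteq> PtTop \<Longrightarrow> (u, v) \<in> W_bot_top P \<longleftrightarrow> (u, v) \<in> K_bot P"
  "(PtTop, u) \<in> W_bot_top P \<longleftrightarrow> u = PtTop"
  by (auto simp: W_bot_top_def)

lemma Field_K_bot: "Field (K_bot P) = Elem ` Field P \<union> {PtA, PtB, PtBot}"
proof
  show "Field (K_bot P) \<subseteq> Elem ` Field P \<union> {PtA, PtB, PtBot}"
  proof
    fix u assume "u \<in> Field (K_bot P)"
    then obtain v where "(u, v) \<in> K_bot P \<or> (v, u) \<in> K_bot P" unfolding Field_def by blast
    then show "u \<in> Elem ` Field P \<union> {PtA, PtB, PtBot}"
      by (auto simp: K_bot_def intro: FieldI1 FieldI2)
  qed
  have "(PtBot, u) \<in> K_bot P" if "u \<in> Elem ` Field P \<union> {PtA, PtB, PtBot}" for u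
    using that by auto
  then show "Elem ` Field P \<union> {PtA, PtB, PtBot} \<subseteq> Field (K_bot P)"
    by (blast intro: FieldI2)
qed

lemma Field_W_bot_top: "Field (W_bot_top P) = Elem ` Field P \<union> {PtA, PtB, PtBot, PtTop}"
  unfolding W_bot_top_def Field_Un Field_K_bot by (auto simp: Field_def[of "_ \<times> _"])

lemma Partial_order_K_bot:
  assumes "Partial_order P" shows "Partial_order (K_bot P)"
proof -
  have r: "(x, x) \<in> P" if "x \<in> Field P" for x using that Partial_order_refl[OF assms] by blast
  have "refl_on (Field (K_bot P)) (K_bot P)"
    by (auto simp: refl_on_def Field_K_bot r)
  moreover have "trans (K_bot P)"
  proof (rule transI)
    fix x y z assume "(x, y) \<in> K_bot P" "(y, z) \<in> K_bot P"
    then show "(x, z) \<in> K_bot P"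
      by (cases x; cases y; cases z)
         (auto intro: Partial_order_trans[OF assms] FieldI1 FieldI2)
  qed
  moreover have "antisym (K_bot P)"
  proof (rule antisymI)
    fix x y assume "(x, y) \<in> K_bot P" "(y, x) \<in> K_bot P"
    then show "x = y"
      by (cases x; cases y) (auto intro: Partial_order_antisym[OF assms])
  qed
  ultimately show ?thesis by (auto simp: order_on_defs intro: FieldI1 FieldI2)
qed

lemma Partial_order_W_bot_top:
  assumes "Partial_order P" shows "Partial_order (W_bot_top P)"
proof -
  note K = Partial_order_K_bot[OF assms]
  have "refl_on (Field (W_bot_top P)) (W_bot_top P)"
    using Partial_order_refl[OF assms]
    by (auto simp: refl_on_def Field_W_bot_top)
  moreover have "trans (W_bot_top P)"
  proof (rule transI)
    fix x y z assume xyz: "(x, y) \<in> W_bot_top P" "(y, z) \<in> W_bot_top P"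
    show "(x, z) \<in> W_bot_top P"
    proof (cases "z = PtTop")
      case True
      then show ?thesis using xyz FieldI1[OF xyz(1)] by (simp add: Field_W_bot_top)
    next
      case False
      then have "y \<noteq> PtTop" using xyz(2) by auto
      then show ?thesis using False xyz Partial_order_trans[OF K] by simp
    qed
  qed
  moreover have "antisym (W_bot_top P)"
  proof (rule antisymI)
    fix x y assume "(x, y) \<in> W_bot_top P" "(y, x) \<in> W_bot_top P"
    then show "x = y"
      by (cases "x = PtTop"; cases "y = PtTop") (auto intro: Partial_order_antisym[OF K])
  qed
  ultimately show ?thesis by (auto simp: order_on_defs intro: FieldI1 FieldI2)
qed

lemma directed_attained_K_bot:
  assumes "downward_well_ordered_chain P" shows "directed_attained (K_bot P)"
proof -
  have P: "Partial_order P"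
    using assms by (simp add: downward_well_ordered_chain_def order_on_defs)
  note po = Partial_order_K_bot[OF P]
  have "\<exists>m\<in>D. \<forall>d\<in>D. (d, m) \<in> K_bot P" if D: "directed_in (K_bot P) D" for D
  proof (cases "D \<subseteq> {PtA, PtB, PtBot}")
    case True
    then show ?thesis using finite_directed_has_greatest[OF po D] by (simp add: finite_subset)
  next
    case False
    have DF: "D \<subseteq> Elem ` Field P \<union> {PtA, PtB, PtBot}"
      using D by (simp add: directed_in_def Field_K_bot)
    \<comment> \<open>The greatest chain element of \<open>D\<close> also dominates the three added
      points, which lie below all of the chain.\<close>
    let ?S = "{x \<in> Field P. Elem x \<in> D}"
    have "?S \<noteq> {}" using False DF by auto
    then obtain g where g: "g \<in> ?S" "\<forall>x\<in>?S. (x, g) \<in> P"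
      using assms[unfolded downward_well_ordered_chain_def, THEN conjunct2, rule_format, of ?S]
      by auto
    then show ?thesis using DF by (intro bexI[of _ "Elem g"]) auto
  qed
  then show ?thesis using po by (simp add: directed_attained_def)
qed

text \<open>Two distinct members of the anti-chain are bounded only by \<open>PtTop\<close>. A
  directed set without \<open>PtTop\<close> therefore has at most one of them, which is then
  greatest.\<close>

lemma directed_attained_W_bot_top:
  assumes "is_antichain P" shows "directed_attained (W_bot_top P)"
proof -
  have P: "Partial_order P" using assms by (simp add: is_antichain_def)
  have anti: "x = y" if "(x, y) \<in> P" for x y
    using assms that unfolding is_antichain_def by (metis FieldI1 FieldI2)
  note po = Partial_order_W_bot_top[OF P]
  have "\<exists>m\<in>D. \<forall>d\<in>D. (d, m) \<in> W_bot_top P" if D: "directed_in (W_bot_top P) D" for D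
  proof -
    have DF: "D \<subseteq> Elem ` Field P \<union> {PtA, PtB, PtBot, PtTop}"
      using D by (simp add: directed_in_def Field_W_bot_top)
    consider "PtTop \<in> D" | e where "PtTop \<notin> D" "Elem e \<in> D" | "D \<subseteq> {PtA, PtB, PtBot}"
      using DF by blast
    then show ?thesis
    proof cases
      case 1
      then show ?thesis using DF by (intro bexI[of _ PtTop]) auto
    next
      case (2 e)
      have "(d, Elem e) \<in> W_bot_top P" if "d \<in> D" for d
      proof -
        obtain z where z: "z \<in> D" "(d, z) \<in> W_bot_top P" "(Elem e, z) \<in> W_bot_top P"
          using D \<open>d \<in> D\<close> 2(2) unfolding directed_in_def by blast
        then show ?thesis using 2(1) anti by (cases z) auto
      qed
      then show ?thesis using 2 by blast
    next
      case 3
      then show ?thesis using finite_directed_has_greatest[OF po D] by (simp add: finite_subset)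
    qed
  qed
  then show ?thesis using po by (simp add: directed_attained_def)
qed

section \<open>Retracts witnessing non-coherence\<close>

text \<open>By coherence \<open>up L {s a} \<inter> up L {s b}\<close> is compact. The map
  \<open>r\<close> sends it into the intersection in \<open>M\<close>, and onto it because
  \<open>s x\<close> is a preimage of \<open>x\<close>.\<close>

lemma coherent_retract_compact:
  assumes coh: "coherent_dcpo L" and ret: "scott_retract M L"
    and a: "a \<in> Field M" and b: "b \<in> Field M"
  shows "compactin (scott_topology M) (up M {a} \<inter> up M {b})"
proof -
  obtain s r where s: "scott_continuous M L s" and r: "scott_continuous L M r"
    and rs: "\<And>x. x \<in> Field M \<Longrightarrow> r (s x) = x" and po: "Partial_order L"
    using ret by (auto simp: scott_retract_def dcpo_def)
  have mono: "\<And>x y. (x, y) \<in> M \<Longrightarrow> (s x, s y) \<in> L" "\<And>x y. (x, y) \<in> L \<Longrightarrow> (r x, r y) \<in> M"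
    and sF: "\<And>x. x \<in> Field M \<Longrightarrow> s x \<in> Field L"
    using s r by (auto simp: scott_continuous_def)
  let ?Q = "up L {s a} \<inter> up L {s b}"
  have "compactin (scott_topology L) ?Q"
    using coh compactin_up_singleton[OF po] saturated_up[OF po] sF a b
    unfolding coherent_dcpo_def coherent_space_def by blast
  then have "compactin (scott_topology M) (r ` ?Q)"
    using image_compactin continuous_map_scott[OF r] by blast
  moreover have "r ` ?Q = up M {a} \<inter> up M {b}"
  proof
    show "r ` ?Q \<subseteq> up M {a} \<inter> up M {b}"
      using mono(2) rs a b by (fastforce simp: up_def)
    show "up M {a} \<inter> up M {b} \<subseteq> r ` ?Q"
    proof
      fix x assume x: "x \<in> up M {a} \<inter> up M {b}"
      then have "s x \<in> ?Q" using mono(1) by (auto simp: up_def)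
      moreover have "r (s x) = x" using x rs by (auto simp: up_def intro: FieldI2)
      ultimately show "x \<in> r ` ?Q" by (metis imageI)
    qed
  qed
  ultimately show ?thesis by simp
qed

text \<open>In \<open>M\<close> every principal filter is open, so the filters of the members of
  \<open>G\<close> form an open cover of \<open>Q\<close>.\<close>

lemma compactin_attained_finite:
  assumes M: "directed_attained M" and Q: "compactin (scott_topology M) Q" "G \<subseteq> Field M"
    and QG: "Q \<subseteq> up M G"
  shows "\<exists>F. finite F \<and> F \<subseteq> G \<and> Q \<subseteq> up M F"
proof -
  let ?\<U> = "(\<lambda>x. up M {x}) ` G"
  have "Ball ?\<U> (openin (scott_topology M))" using scott_open_up_attained[OF M] by auto
  moreover have "Q \<subseteq> \<Union>?\<U>" using QG by (auto simp: up_def)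
  ultimately obtain \<F> where \<F>: "finite \<F>" "\<F> \<subseteq> ?\<U>" "Q \<subseteq> \<Union>\<F>"
    using Q unfolding compactin_def by meson
  then obtain F where "finite F" "F \<subseteq> G" "\<F> = (\<lambda>x. up M {x}) ` F"
    by (meson finite_subset_image)
  then show ?thesis using \<F>(3) by (intro exI[of _ F]) (auto simp: up_def)
qed

lemma not_coherent_if_K_bot_retract:
  assumes C: "downward_well_ordered_chain C" "Field C \<noteq> {}" "\<not> (\<exists>m. is_least C m)"
    and ret: "scott_retract (K_bot C) L"
  shows "\<not> coherent_dcpo L"
proof
  assume "coherent_dcpo L"
  let ?M = "K_bot C"
  have lin: "Linear_order C" and P: "Partial_order C"
    using C(1) by (simp_all add: downward_well_ordered_chain_def order_on_defs)
  have Q: "up ?M {PtA} \<inter> up ?M {PtB} = Elem ` Field C"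
    by (auto simp: up_def K_bot_def)
  have "compactin (scott_topology ?M) (Elem ` Field C)"
    using coherent_retract_compact[OF \<open>coherent_dcpo L\<close> ret, of PtA PtB] Q
    by (simp add: Field_K_bot)
  moreover have "Elem ` Field C \<subseteq> up ?M (Elem ` Field C)"
    using Partial_order_refl[OF P] by (force simp: up_def)
  ultimately obtain F where F: "finite F" "F \<subseteq> Elem ` Field C" "Elem ` Field C \<subseteq> up ?M F"
    using compactin_attained_finite[OF directed_attained_K_bot[OF C(1)]]
    by (metis Field_K_bot Un_upper1)
  then obtain G where G: "finite G" "G \<subseteq> Field C" "F = Elem ` G"
    by (meson finite_subset_image)
  have "\<exists>m\<in>G. \<forall>x\<in>G. (m, x) \<in> C"
  proof -
    have "\<exists>m\<in>Field C. \<forall>x\<in>H. (m, x) \<in> C" if "finite H" "H \<subseteq> Field C" for H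
      using that
    proof (induction H rule: finite_induct)
      case empty
      then show ?case using C(2) by auto
    next
      case (insert x H)
      then obtain m where m: "m \<in> Field C" "\<forall>x\<in>H. (m, x) \<in> C" by blast
      have "x \<in> Field C" using insert.prems by blast
      then have "(x, m) \<in> C \<or> (m, x) \<in> C"
        using lin m(1) Partial_order_refl[OF P] by (cases "x = m") (auto simp: order_on_defs total_on_def)
      then show ?case
        using m \<open>x \<in> Field C\<close> Partial_order_trans[OF P] Partial_order_refl[OF P] by blast
    qed
    \<comment> \<open>The lower bound \<open>m\<close> of \<open>G\<close> is itself covered by some
      \<open>g\<close> in \<open>G\<close>; this \<open>g\<close> is then least in \<open>G\<close>,
      and hence least in \<open>C\<close>.\<close>
    then obtain m where m: "m \<in> Field C" "\<forall>x\<in>G. (m, x) \<in> C" using G by blast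
    then obtain g where "g \<in> G" "(g, m) \<in> C" using F(3) G(3) by (auto simp: up_def)
    then show ?thesis using m Partial_order_trans[OF P] by blast
  qed
  then obtain m where m: "m \<in> G" "\<forall>x\<in>G. (m, x) \<in> C" by blast
  have "(m, x) \<in> C" if x: "x \<in> Field C" for x
  proof -
    obtain g where "g \<in> G" "(g, x) \<in> C" using F(3) G(3) x by (auto simp: up_def)
    then show ?thesis using m(2) Partial_order_trans[OF P] by blast
  qed
  then show False using C(3) m(1) G(2) unfolding is_least_def by blast
qed

lemma not_coherent_if_W_bot_top_retract:
  assumes E: "is_antichain E" "infinite (Field E)" and ret: "scott_retract (W_bot_top E) L"
  shows "\<not> coherent_dcpo L"
proof
  assume "coherent_dcpo L"
  let ?M = "W_bot_top E"
  have P: "Partial_order E" using E by (simp add: is_antichain_def)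
  have anti: "x = y" if "(x, y) \<in> E" for x y
    using E(1) that unfolding is_antichain_def by (metis FieldI1 FieldI2)
  let ?Q = "insert PtTop (Elem ` Field E)"
  have Q: "up ?M {PtA} \<inter> up ?M {PtB} = ?Q"
    by (auto simp: up_def W_bot_top_def K_bot_def)
  have "compactin (scott_topology ?M) ?Q"
    using coherent_retract_compact[OF \<open>coherent_dcpo L\<close> ret, of PtA PtB] Q
    by (simp add: Field_W_bot_top)
  moreover have "?Q \<subseteq> up ?M (Elem ` Field E)"
  proof -
    have "Field E \<noteq> {}" using E(2) by auto
    then show ?thesis using Partial_order_refl[OF P] by (force simp: up_def)
  qed
  moreover have "Elem ` Field E \<subseteq> Field ?M" by (auto simp: Field_W_bot_top)
  ultimately obtain F where F: "finite F" "F \<subseteq> Elem ` Field E" "?Q \<subseteq> up ?M F"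
    using compactin_attained_finite[OF directed_attained_W_bot_top[OF E(1)]] by meson
  \<comment> \<open>Only the filter of \<open>u\<close> itself can cover \<open>u\<close>, since the
    generators in \<open>F\<close> come from the anti-chain.\<close>
  have "Elem ` Field E \<subseteq> F"
  proof
    fix u assume u: "u \<in> Elem ` Field E"
    then obtain v where v: "v \<in> F" "(v, u) \<in> ?M" using F(3) by (auto simp: up_def)
    then show "u \<in> F" using u F(2) by (cases v) (auto dest: anti)
  qed
  then have "finite (Elem ` Field E)" using F(1) finite_subset by blast
  moreover have "inj_on Elem (Field E)" by (simp add: inj_on_def)
  ultimately show False using E(2) finite_imageD by blast
qed

section \<open>Retracts from a non-compact intersection\<close>

text \<open>The elements of a chain that lie below all their predecessors in an auxiliary
  well-order of the chain.\<close>

lemma dually_well_ordered_coinitial: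
  assumes po: "Partial_order r" and Ch: "Ch \<subseteq> Field r"
    and tot: "\<And>x y. x \<in> Ch \<Longrightarrow> y \<in> Ch \<Longrightarrow> (x, y) \<in> r \<or> (y, x) \<in> r"
  obtains C where "C \<subseteq> Ch"
    and "\<And>S. S \<subseteq> C \<Longrightarrow> S \<noteq> {} \<Longrightarrow> \<exists>g\<in>S. \<forall>x\<in>S. (x, g) \<in> r"
    and "\<And>x. x \<in> Ch \<Longrightarrow> \<exists>c\<in>C. (c, x) \<in> r"
proof -
  obtain w where w: "well_order_on Ch w" using well_order_on by blast
  have min: "\<exists>m\<in>S. \<forall>x\<in>Ch. (x, m) \<in> w - Id \<longrightarrow> x \<notin> S" if "S \<noteq> {}" for S
    using w that unfolding well_order_on_def by (meson wfE_min ex_in_conv)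
  have w_tot: "x = y \<or> (x, y) \<in> w - Id \<or> (y, x) \<in> w - Id" if "x \<in> Ch" "y \<in> Ch" for x y
    using w that by (auto simp: order_on_defs total_on_def)
  define C where "C = {c \<in> Ch. \<forall>d\<in>Ch. (d, c) \<in> w - Id \<longrightarrow> (c, d) \<in> r}"
  show thesis
  proof
    show "C \<subseteq> Ch" by (auto simp: C_def)
  next
    fix S assume S: "S \<subseteq> C" "S \<noteq> {}"
    \<comment> \<open>The \<open>w\<close>-least member of \<open>S\<close> is its greatest one for
      \<open>r\<close>: the others come later in \<open>w\<close> and so lie below it.\<close>
    then obtain m where m: "m \<in> S" "\<forall>x\<in>Ch. (x, m) \<in> w - Id \<longrightarrow> x \<notin> S" using min[of S] by meson
    have "(x, m) \<in> r" if x: "x \<in> S" for x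
    proof (cases "x = m")
      case True
      then show ?thesis using x S Ch Partial_order_refl[OF po] by (auto simp: C_def)
    next
      case False
      have "x \<in> Ch" "m \<in> Ch" using x m S by (auto simp: C_def)
      then have "(m, x) \<in> w - Id" using w_tot[of x m] False m x by blast
      then show ?thesis using x S \<open>m \<in> Ch\<close> by (auto simp: C_def)
    qed
    then show "\<exists>g\<in>S. \<forall>x\<in>S. (x, g) \<in> r" using m(1) by blast
  next
    fix x assume x: "x \<in> Ch"
    let ?T = "{y \<in> Ch. (y, x) \<in> r}"
    have "x \<in> ?T" using x Ch Partial_order_refl[OF po] by auto
    then have "?T \<noteq> {}" by blast
    \<comment> \<open>Take the \<open>w\<close>-least \<open>m\<close> below \<open>x\<close>. An
      earlier \<open>d\<close> is not below \<open>x\<close>, hence lies above \<open>x\<close> and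
      so above \<open>m\<close>; thus \<open>m\<close> belongs to \<open>C\<close>.\<close>
    then obtain m where m: "m \<in> ?T" "\<forall>y\<in>Ch. (y, m) \<in> w - Id \<longrightarrow> y \<notin> ?T" using min[of ?T] by meson
    have "(m, d) \<in> r" if "d \<in> Ch" "(d, m) \<in> w - Id" for d
      using that m tot[OF x that(1)] Partial_order_trans[OF po] by blast
    then have "m \<in> C" using m(1) by (auto simp: C_def)
    then show "\<exists>c\<in>C. (c, x) \<in> r" using m(1) by blast
  qed
qed

section \<open>The common shape of the two retractions and their sections\<close>

definition glue :: "'a rel \<Rightarrow> 'a \<Rightarrow> 'a \<Rightarrow> ('a \<Rightarrow> 'c ext) \<Rightarrow> 'a \<Rightarrow> 'c ext" where
  "glue r a b h x =
     (if (a, x) \<in> r then if (b, x) \<in> r then h x else PtA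
      else if (b, x) \<in> r then PtB else PtBot)"

text \<open>Outside \<open>up r {a} \<inter> up r {b}\<close> the map depends only on which of
  \<open>a\<close> and \<open>b\<close> lie below the argument, and compactness makes this
  information reach a member of \<open>D\<close>. Inside, everything is delegated to
  \<open>h\<close>.\<close>

lemma scott_continuous_glue:
  assumes po: "Partial_order r" and poM: "Partial_order M"
    and a: "a \<in> compact_elements r" and b: "b \<in> compact_elements r"
    and lo: "(PtBot, PtA) \<in> M" "(PtBot, PtB) \<in> M"
    and low: "\<And>x. x \<in> up r {a} \<inter> up r {b} \<Longrightarrow> (PtA, h x) \<in> M \<and> (PtB, h x) \<in> M"
    and mono: "\<And>x y. x \<in> up r {a} \<inter> up r {b} \<Longrightarrow> (x, y) \<in> r \<Longrightarrow> (h x, h y) \<in> M"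
    and att: "\<And>D s. directed_in r D \<Longrightarrow> is_sup r D s \<Longrightarrow> s \<in> up r {a} \<inter> up r {b} \<Longrightarrow>
      \<exists>d\<in>D. d \<in> up r {a} \<inter> up r {b} \<and> (h s, h d) \<in> M"
  shows "scott_continuous r M (glue r a b h)"
proof (rule scott_continuous_if_attained[OF po poM])
  have tr: "(x, z) \<in> r" if "(x, y) \<in> r" "(y, z) \<in> r" for x y z
    using Partial_order_trans[OF po] that by blast
  have refls: "(PtA, PtA) \<in> M" "(PtB, PtB) \<in> M" "(PtBot, PtBot) \<in> M"
    using lo Partial_order_refl[OF poM] by (auto intro: FieldI1 FieldI2)
  have botM: "(PtBot, h x) \<in> M" if "x \<in> up r {a} \<inter> up r {b}" for x
    using low[OF that] lo Partial_order_trans[OF poM] by blast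
  show "(glue r a b h x, glue r a b h y) \<in> M" if "(x, y) \<in> r" for x y
    using tr[OF _ that] refls lo low[of y] botM[of y] mono[of x y] that
    by (auto simp: glue_def up_def)
  fix D s assume D: "directed_in r D" and s: "is_sup r D s"
  have up: "(d, s) \<in> r" if "d \<in> D" for d using s that by (rule is_sup_upper)
  show "\<exists>d\<in>D. (glue r a b h s, glue r a b h d) \<in> M"
  proof (cases "s \<in> up r {a} \<inter> up r {b}")
    case True
    then obtain d where "d \<in> D" "d \<in> up r {a} \<inter> up r {b}" "(h s, h d) \<in> M"
      using att[OF D s] by blast
    then show ?thesis using True by (intro bexI[of _ d]) (auto simp: glue_def up_def)
  next
    case False
    \<comment> \<open>Since \<open>s\<close> is above at most one of \<open>a\<close> and
      \<open>b\<close>, a single use of compactness is enough, or any member of \<open>D\<close>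
      will do.\<close>
    have "\<exists>d\<in>D. ((a, s) \<in> r \<longrightarrow> (a, d) \<in> r) \<and> ((b, s) \<in> r \<longrightarrow> (b, d) \<in> r)"
      using False D compact_elementD[OF a D s] compact_elementD[OF b D s]
      unfolding directed_in_def up_def by blast
    then obtain d where d: "d \<in> D" "(a, s) \<in> r \<Longrightarrow> (a, d) \<in> r" "(b, s) \<in> r \<Longrightarrow> (b, d) \<in> r"
      by blast
    have "glue r a b h d = glue r a b h s"
      using False d tr[OF _ up[OF d(1)]] by (auto simp: glue_def up_def)
    then show ?thesis using d(1) False refls by (intro bexI[of _ d]) (auto simp: glue_def up_def)
  qed
qed

text \<open>The section matching \<open>glue\<close>. The chain case passes \<open>lo\<close> for
  \<open>hi\<close> as well, a dummy value because \<open>PtTop\<close> is then outside the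
  carrier.\<close>

fun place :: "'a \<Rightarrow> 'a \<Rightarrow> 'a \<Rightarrow> 'a \<Rightarrow> 'a ext \<Rightarrow> 'a" where
  "place a b lo hi (Elem x) = x"
| "place a b lo hi PtA = a"
| "place a b lo hi PtB = b"
| "place a b lo hi PtBot = lo"
| "place a b lo hi PtTop = hi"

lemma glue_place:
  assumes "Partial_order r" and least: "is_least r lo"
    and ab: "a \<in> Field r" "b \<in> Field r" "(a, b) \<notin> r" "(b, a) \<notin> r"
    and "\<And>x. u = Elem x \<Longrightarrow> x \<in> up r {a} \<inter> up r {b} \<and> h x = Elem x"
    and "u = PtTop \<Longrightarrow> hi \<in> up r {a} \<inter> up r {b} \<and> h hi = PtTop"
  shows "glue r a b h (place a b lo hi u) = u"
proof (cases u)
  case PtBot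
  \<comment> \<open>If \<open>a\<close> were below \<open>lo\<close>, it would be below
    \<open>b\<close>, against incomparability; symmetrically for \<open>b\<close>.\<close>
  have "(a, lo) \<notin> r" "(b, lo) \<notin> r"
    using least ab Partial_order_trans[OF assms(1)] unfolding is_least_def by blast+
  then show ?thesis using PtBot by (simp add: glue_def)
qed (use assms Partial_order_refl[OF assms(1)] in \<open>auto simp: glue_def up_def\<close>)

text \<open>A point \<open>x\<close> above \<open>a\<close> and \<open>b\<close> need not lie above any member of \<open>C\<close>. It is therefore sent
  to the greatest \<open>c\<close> such that \<open>x\<close> lies below no member of \<open>C\<close> strictly below \<open>c\<close>.\<close>

lemma K_bot_retract:
  assumes dcpo: "dcpo r" and least: "is_least r lo"
    and a: "a \<in> compact_elements r" and b: "b \<in> compact_elements r"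
    and ab: "(a, b) \<notin> r" "(b, a) \<notin> r"
    and C: "C \<subseteq> up r {a} \<inter> up r {b}"
    and dwo: "\<And>S. S \<subseteq> C \<Longrightarrow> S \<noteq> {} \<Longrightarrow> \<exists>g\<in>S. \<forall>x\<in>S. (x, g) \<in> r"
    and nolb: "\<And>x. x \<in> up r {a} \<inter> up r {b} \<Longrightarrow> \<exists>c\<in>C. (x, c) \<notin> r"
  shows "downward_well_ordered_chain (Restr r C)"
    and "\<not> (\<exists>m. is_least (Restr r C) m)"
    and "scott_retract (K_bot (Restr r C)) r"
proof -
  note po = dcpo_Partial_order[OF dcpo]
  let ?U = "up r {a} \<inter> up r {b}" and ?P = "Restr r C"
  let ?M = "K_bot ?P"
  have tr: "(x, z) \<in> r" if "(x, y) \<in> r" "(y, z) \<in> r" for x y z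
    using Partial_order_trans[OF po] that by blast
  have abF: "a \<in> Field r" "b \<in> Field r" using a b by (simp_all add: compact_elements_Field)
  have CF: "C \<subseteq> Field r" using C up_subset_Field[of r] by blast
  have FP: "Field ?P = C"
  proof
    show "Field ?P \<subseteq> C" by (auto simp: Field_def)
    show "C \<subseteq> Field ?P" using CF Partial_order_refl[OF po] by (blast intro: FieldI1)
  qed
  have "(x, y) \<in> r \<or> (y, x) \<in> r" if "x \<in> C" "y \<in> C" for x y
    using dwo[of "{x, y}"] that by auto
  moreover have poP: "Partial_order ?P"
    unfolding partial_order_on_def preorder_on_def FP
    using CF Partial_order_refl[OF po] tr Partial_order_antisym[OF po]
    by (auto simp: refl_on_def intro!: transI antisymI)
  ultimately have "Linear_order ?P" using FP by (auto simp: linear_order_on_def total_on_def)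
  then show chain: "downward_well_ordered_chain ?P"
    unfolding downward_well_ordered_chain_def FP
  proof (intro conjI allI impI)
    fix S assume S: "S \<subseteq> C \<and> S \<noteq> {}"
    then obtain g where "g \<in> S" "\<forall>x\<in>S. (x, g) \<in> r" using dwo[of S] by meson
    then show "\<exists>g\<in>S. \<forall>x\<in>S. (x, g) \<in> ?P" using S by auto
  qed
  show "\<not> (\<exists>m. is_least ?P m)"
    using nolb C unfolding is_least_def FP by blast
  have att: "directed_attained ?M" by (rule directed_attained_K_bot[OF chain])
  then have poM: "Partial_order ?M" by (simp add: directed_attained_def)
  define S where "S x = {c \<in> C. \<forall>d\<in>C. (d, c) \<in> r \<and> d \<noteq> c \<longrightarrow> (x, d) \<notin> r}" for x
  define g where "g x = (SOME c. c \<in> S x \<and> (\<forall>d\<in>S x. (d, c) \<in> r))" for x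
  have g: "g x \<in> S x" "\<And>c. c \<in> S x \<Longrightarrow> (c, g x) \<in> r" if x: "x \<in> ?U" for x
  proof -
    obtain c where "c \<in> C" "(x, c) \<notin> r" using nolb[OF x] by blast
    then have "c \<in> S x" using tr by (auto simp: S_def)
    moreover have "S x \<subseteq> C" by (auto simp: S_def)
    ultimately have "\<exists>c. c \<in> S x \<and> (\<forall>d\<in>S x. (d, c) \<in> r)" using dwo[of "S x"] by blast
    from someI_ex[OF this] show "g x \<in> S x" "\<And>c. c \<in> S x \<Longrightarrow> (c, g x) \<in> r"
      by (auto simp: g_def)
  qed
  have gC: "g x \<in> C" if "x \<in> ?U" for x using g(1)[OF that] by (simp add: S_def)
  have U_up: "y \<in> ?U" if "x \<in> ?U" "(x, y) \<in> r" for x y using that up_upper[OF po] by blast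
  have g_mono: "(g x, g y) \<in> r" if x: "x \<in> ?U" and xy: "(x, y) \<in> r" for x y
  proof -
    \<comment> \<open>A larger point lies below fewer members of \<open>C\<close>, so its candidate
      set grows and so does the greatest candidate.\<close>
    have "S x \<subseteq> S y" using tr[OF xy] by (auto simp: S_def)
    then show ?thesis using g[OF x] g[OF U_up[OF x xy]] by blast
  qed
  have g_att: "\<exists>d\<in>D. d \<in> ?U \<and> (g s, g d) \<in> r"
    if D: "directed_in r D" and s: "is_sup r D s" and sU: "s \<in> ?U" for D s
  proof -
    have oU: "scott_open r ?U"
      using scott_open_up[OF po] a b by (intro scott_open_Int) auto
    let ?D = "D \<inter> ?U"
    obtain d\<^sub>0 where d0: "d\<^sub>0 \<in> ?D" using scott_open_meets[OF oU D s sU] by blast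
    \<comment> \<open>The values of \<open>g\<close> lie in the dually well-ordered
      \<open>C\<close>, so some \<open>d\<close> maximises \<open>g\<close> on
      \<open>?D\<close>.\<close>
    then have "\<exists>m\<in>g ` ?D. \<forall>x\<in>g ` ?D. (x, m) \<in> r" using gC by (intro dwo) auto
    then obtain d where d: "d \<in> ?D" "\<And>e. e \<in> ?D \<Longrightarrow> (g e, g d) \<in> r" by blast
    have "(g s, g d) \<in> r"
    proof (rule ccontr)
      assume n: "(g s, g d) \<notin> r"
      \<comment> \<open>If \<open>g s\<close> exceeded all values on \<open>?D\<close>, each
        \<open>e\<close> there would lie below a member of \<open>C\<close> strictly below
        \<open>g s\<close>, hence below the greatest such member \<open>m\<close>. Then
        \<open>s\<close> would also lie below \<open>m\<close>, contradicting the choice of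
        \<open>g s\<close>.\<close>
      let ?B = "{c \<in> C. (c, g s) \<in> r \<and> c \<noteq> g s}"
      have B_above: "\<exists>c\<in>?B. (e, c) \<in> r" if "e \<in> ?D" for e
      proof -
        have "g s \<notin> S e" using g(2)[of e "g s"] d(2)[OF that] n tr that by blast
        then show ?thesis using gC[OF sU] by (auto simp: S_def)
      qed
      then have "?B \<noteq> {}" using d(1) by blast
      then obtain m where m: "m \<in> ?B" "\<forall>c\<in>?B. (c, m) \<in> r" using dwo[of ?B] by blast
      have "(s, m) \<in> r"
        using s
      proof (rule is_sup_least)
        show "m \<in> Field r" using m(1) CF by blast
        fix e assume e: "e \<in> D"
        \<comment> \<open>A member of \<open>D\<close> outside \<open>?U\<close> is first raised
          above \<open>d\<close>, which moves it into \<open>?U\<close>.\<close>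
        obtain z where z: "z \<in> D" "(e, z) \<in> r" "(d, z) \<in> r"
          using D e d(1) unfolding directed_in_def by blast
        then have "z \<in> ?D" using d(1) U_up by blast
        then show "(e, m) \<in> r" using B_above m(2) tr z(2) by blast
      qed
      then show False using g(1)[OF sU] m(1) by (auto simp: S_def)
    qed
    then show ?thesis using d(1) by blast
  qed
  have "scott_continuous r ?M (glue r a b (\<lambda>x. Elem (g x)))"
  proof (intro scott_continuous_glue[OF po poM a b])
    show "(PtA, Elem (g x)) \<in> ?M \<and> (PtB, Elem (g x)) \<in> ?M" if "x \<in> ?U" for x
      using gC[OF that] FP by simp
    show "(Elem (g x), Elem (g y)) \<in> ?M" if "x \<in> ?U" "(x, y) \<in> r" for x y
      using g_mono[OF that] gC[OF that(1)] gC[OF U_up[OF that]] by simp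
    show "\<exists>d\<in>D. d \<in> ?U \<and> (Elem (g s), Elem (g d)) \<in> ?M"
      if D: "directed_in r D" "is_sup r D s" and sU: "s \<in> ?U" for D s
    proof -
      obtain d where "d \<in> D" "d \<in> ?U" "(g s, g d) \<in> r" using g_att[OF D sU] by blast
      then show ?thesis using gC[of d] gC[OF sU] by (intro bexI[of _ d]) simp_all
    qed
  qed simp_all
  moreover have "scott_continuous ?M r (place a b lo lo)"
  proof (rule scott_continuous_from_attained[OF att])
    fix u v assume "(u, v) \<in> ?M"
    then show "(place a b lo lo u, place a b lo lo v) \<in> r"
      using FP C CF least abF Partial_order_refl[OF po]
      by (cases u; cases v) (auto simp: up_def is_least_def)
  qed
  moreover have "glue r a b (\<lambda>x. Elem (g x)) (place a b lo lo u) = u" if u: "u \<in> Field ?M" for u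
  proof (rule glue_place[OF po least _ _ ab])
    fix x assume "u = Elem x"
    then have xC: "x \<in> C" using u by (auto simp: Field_K_bot FP)
    then have xU: "x \<in> ?U" using C by blast
    \<comment> \<open>So \<open>x\<close> is below \<open>g x\<close>; were it strictly below,
      \<open>x\<close> itself would be a member of \<open>C\<close> above \<open>x\<close> that
      excludes \<open>g x\<close> from \<open>S x\<close>.\<close>
    have "x \<in> S x" using xC Partial_order_antisym[OF po] by (auto simp: S_def)
    then have "(x, g x) \<in> r" by (rule g(2)[OF xU])
    moreover have "(x, x) \<in> r" using xC CF Partial_order_refl[OF po] by blast
    ultimately have "g x = x" using g(1)[OF xU] xC by (auto simp: S_def)
    then show "x \<in> ?U \<and> Elem (g x) = Elem x" using xU by simp
  qed (use u abF in \<open>auto simp: Field_K_bot\<close>)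
  ultimately show "scott_retract ?M r"
    using dcpo directed_attained_dcpo[OF att] unfolding scott_retract_def by blast
qed

text \<open>Continuity rests on the compactness of the members of \<open>E\<close>: one lying below
  a directed supremum already lies below a member of the directed set, and two do so simultaneously
  by directedness. \<open>Id_on E\<close> is the discrete order with carrier
  \<open>E\<close>.\<close>

lemma W_bot_top_retract:
  assumes dcpo: "dcpo r" and least: "is_least r lo" and greatest: "is_greatest r hi"
    and a: "a \<in> compact_elements r" and b: "b \<in> compact_elements r"
    and ab: "(a, b) \<notin> r" "(b, a) \<notin> r"
    and E: "E \<subseteq> up r {a} \<inter> up r {b}" and inf: "infinite E"
    and Ec: "E \<subseteq> compact_elements r"
    and anti: "\<And>e e'. e \<in> E \<Longrightarrow> e' \<in> E \<Longrightarrow> (e, e') \<in> r \<Longrightarrow> e = e'"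
    and above: "\<And>x. x \<in> up r {a} \<inter> up r {b} \<Longrightarrow> \<exists>e\<in>E. (e, x) \<in> r"
  shows "is_antichain (Id_on E)" and "scott_retract (W_bot_top (Id_on E)) r"
proof -
  note po = dcpo_Partial_order[OF dcpo]
  let ?U = "up r {a} \<inter> up r {b}" and ?P = "Id_on E"
  let ?M = "W_bot_top ?P"
  have tr: "(x, z) \<in> r" if "(x, y) \<in> r" "(y, z) \<in> r" for x y z
    using Partial_order_trans[OF po] that by blast
  have abF: "a \<in> Field r" "b \<in> Field r" using a b by (simp_all add: compact_elements_Field)
  have FP: "Field ?P = E" by (auto simp: Field_def)
  show ac: "is_antichain ?P"
    unfolding is_antichain_def FP
    by (auto simp: order_on_defs refl_on_def trans_def antisym_def FP)
  have att: "directed_attained ?M" by (rule directed_attained_W_bot_top[OF ac])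
  then have poM: "Partial_order ?M" by (simp add: directed_attained_def)
  define h where "h x = (if \<exists>!e. e \<in> E \<and> (e, x) \<in> r then Elem (THE e. e \<in> E \<and> (e, x) \<in> r)
    else PtTop)" for x
  have h_Elem: "h x = Elem e"
    if "e \<in> E" "(e, x) \<in> r" "\<And>e'. e' \<in> E \<Longrightarrow> (e', x) \<in> r \<Longrightarrow> e' = e" for x e
  proof -
    have "\<exists>!e. e \<in> E \<and> (e, x) \<in> r" using that by blast
    moreover have "(THE e. e \<in> E \<and> (e, x) \<in> r) = e" using that by blast
    ultimately show ?thesis by (simp add: h_def)
  qed
  have h_Top: "h x = PtTop" if "e \<in> E" "e' \<in> E" "(e, x) \<in> r" "(e', x) \<in> r" "e \<noteq> e'" for x e e'
    using that by (auto simp: h_def)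
  have h_cases: "(\<exists>e\<in>E. (e, x) \<in> r \<and> (\<forall>e'\<in>E. (e', x) \<in> r \<longrightarrow> e' = e) \<and> h x = Elem e) \<or>
      (\<exists>e\<in>E. \<exists>e'\<in>E. (e, x) \<in> r \<and> (e', x) \<in> r \<and> e \<noteq> e' \<and> h x = PtTop)"
    if xU: "x \<in> ?U" for x
  proof -
    obtain e where e: "e \<in> E" "(e, x) \<in> r" using above[OF xU] by blast
    show ?thesis
    proof (cases "\<forall>e'\<in>E. (e', x) \<in> r \<longrightarrow> e' = e")
      case True
      then have "h x = Elem e" using e h_Elem by meson
      then show ?thesis using e True by meson
    next
      case False
      then obtain e' where e': "e' \<in> E" "(e', x) \<in> r" "e \<noteq> e'" by blast
      then have "h x = PtTop" using e h_Top by meson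
      then show ?thesis using e e' by meson
    qed
  qed
  have U_up: "y \<in> ?U" if "x \<in> ?U" "(x, y) \<in> r" for x y using that up_upper[OF po] by blast
  have E_up: "y \<in> ?U" if "e \<in> E" "(e, y) \<in> r" for e y using that E U_up by blast
  have "scott_continuous r ?M (glue r a b h)"
  proof (rule scott_continuous_glue[OF po poM a b])
    show "(PtA, h x) \<in> ?M \<and> (PtB, h x) \<in> ?M" if "x \<in> ?U" for x
      using h_cases[OF that] FP by auto
    show "(h x, h y) \<in> ?M" if x: "x \<in> ?U" and xy: "(x, y) \<in> r" for x y
      using h_cases[OF U_up[OF x xy]]
    proof (elim disjE bexE conjE)
      fix e assume e: "e \<in> E" "\<forall>e'\<in>E. (e', y) \<in> r \<longrightarrow> e' = e" "h y = Elem e"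
      then have ex: "e' = e" if "e' \<in> E" "(e', x) \<in> r" for e' using that tr[OF _ xy] by blast
      \<comment> \<open>Some member of \<open>E\<close> lies below \<open>x\<close>, and being below
        \<open>y\<close> too it can only be \<open>e\<close>.\<close>
      obtain e' where "e' \<in> E" "(e', x) \<in> r" using above[OF x] by blast
      then have "h x = Elem e" using ex by (intro h_Elem) auto
      then show ?thesis using e(1,3) by (simp add: Id_on_iff)
    next
      fix e assume "h y = PtTop"
      then show ?thesis using h_cases[OF x] FP by auto
    qed
    show "\<exists>d\<in>D. d \<in> ?U \<and> (h s, h d) \<in> ?M"
      if D: "directed_in r D" and s: "is_sup r D s" and sU: "s \<in> ?U" for D s
      using h_cases[OF sU]
    proof (elim disjE bexE conjE)
      fix e assume e: "e \<in> E" "(e, s) \<in> r" "\<forall>e'\<in>E. (e', s) \<in> r \<longrightarrow> e' = e" "h s = Elem e"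
      then obtain d where d: "d \<in> D" "(e, d) \<in> r" using compact_elementD[OF _ D s] Ec by blast
      then have "h d = Elem e" using d(2) e(1,3) tr[OF _ is_sup_upper[OF s d(1)]] by (intro h_Elem) blast+
      then show ?thesis using d(1) e(1,4) E_up[OF e(1) d(2)] by (intro bexI[of _ d]) (simp_all add: Id_on_iff)
    next
      fix e e' assume e: "e \<in> E" "e' \<in> E" "(e, s) \<in> r" "(e', s) \<in> r" "e \<noteq> e'" "h s = PtTop"
      then obtain d d' where d: "d \<in> D" "(e, d) \<in> r" "d' \<in> D" "(e', d') \<in> r"
        using compact_elementD[OF _ D s] Ec by blast
      then obtain z where z: "z \<in> D" "(d, z) \<in> r" "(d', z) \<in> r"
        using D unfolding directed_in_def by blast
      then have ez: "(e, z) \<in> r" "(e', z) \<in> r" using d tr by blast+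
      then have "h z = PtTop" using h_Top[of e e' z] e by blast
      then show ?thesis using z(1) e(6) E_up[OF e(1) ez(1)] by (intro bexI[of _ z]) simp_all
    qed
  qed auto
  moreover have "scott_continuous ?M r (place a b lo hi)"
  proof (rule scott_continuous_from_attained[OF att])
    have F: "x \<in> Field r" if "x \<in> E \<or> x = a \<or> x = b \<or> x = lo \<or> x = hi" for x
      using that Ec abF compact_elements_Field[of _ r] least greatest
      unfolding is_least_def is_greatest_def by blast
    fix u v assume "(u, v) \<in> ?M"
    then show "(place a b lo hi u, place a b lo hi v) \<in> r"
      using FP E F least greatest Partial_order_refl[OF po]
      by (cases u; cases v) (auto simp: up_def is_least_def is_greatest_def)
  qed
  moreover have "glue r a b h (place a b lo hi u) = u" if u: "u \<in> Field ?M" for u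
  proof (rule glue_place[OF po least _ _ ab])
    fix x assume "u = Elem x"
    then have xE: "x \<in> E" using u by (auto simp: Field_W_bot_top FP)
    moreover have "(x, x) \<in> r"
      using xE Ec by (meson compact_elements_Field Partial_order_refl[OF po] subsetD)
    ultimately show "x \<in> ?U \<and> h x = Elem x" using E h_Elem[of x x] anti by blast
  next
    have topE: "(e, hi) \<in> r" if "e \<in> E" for e
      using that Ec greatest compact_elements_Field[of e] unfolding is_greatest_def by blast
    \<comment> \<open>An infinite \<open>E\<close> has two distinct members below \<open>hi\<close>,
      which sends \<open>hi\<close> to \<open>PtTop\<close>.\<close>
    obtain e where e: "e \<in> E" using inf by (metis ex_in_conv finite.emptyI)
    then obtain e' where "e' \<in> E" "e' \<noteq> e"
      using inf by (metis finite.emptyI finite_insert finite_subset insertCI subsetI)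
    then show "hi \<in> ?U \<and> h hi = PtTop" using e topE h_Top[of e e' hi] E_up by blast
  qed (use abF in auto)
  ultimately show "scott_retract ?M r"
    using dcpo directed_attained_dcpo[OF att] unfolding scott_retract_def by blast
qed

text \<open>Zorn's lemma for the reversed order, restricted to the part of \<open>U\<close> below
  \<open>x\<close>. Anything in \<open>U\<close> below a minimal element of that part is again in
  it, so minimality there is minimality in \<open>U\<close>.\<close>

lemma exists_minimal_below:
  assumes po: "Partial_order r" and U: "U \<subseteq> Field r" and x: "x \<in> U"
    and chain: "\<And>Ch. Ch \<subseteq> U \<Longrightarrow> Ch \<noteq> {} \<Longrightarrow> (\<And>x y. x \<in> Ch \<Longrightarrow> y \<in> Ch \<Longrightarrow> (x, y) \<in> r \<or> (y, x) \<in> r)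
      \<Longrightarrow> \<exists>l\<in>U. \<forall>c\<in>Ch. (l, c) \<in> r"
  shows "\<exists>e\<in>U. (e, x) \<in> r \<and> (\<forall>y\<in>U. (y, e) \<in> r \<longrightarrow> y = e)"
proof -
  let ?V = "{y \<in> U. (y, x) \<in> r}"
  let ?R = "(Restr r ?V)\<inverse>"
  have tr: "(x, z) \<in> r" if "(x, y) \<in> r" "(y, z) \<in> r" for x y z
    using Partial_order_trans[OF po] that by blast
  have xV: "x \<in> ?V" using x U Partial_order_refl[OF po] by auto
  have FR: "Field ?R = ?V"
  proof
    show "Field ?R \<subseteq> ?V" by (auto simp: Field_def)
    show "?V \<subseteq> Field ?R" using U Partial_order_refl[OF po] by (blast intro: FieldI1)
  qed
  have "Partial_order (Restr r ?V)"
    using po Partial_order_Restr by blast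
  then have "Partial_order ?R" by simp
  moreover have "\<exists>u\<in>Field ?R. \<forall>c\<in>Ch. (c, u) \<in> ?R" if "Ch \<in> Chains ?R" for Ch
  proof (cases "Ch = {}")
    case True
    then show ?thesis using xV FR by blast
  next
    case False
    have Ch: "Ch \<subseteq> ?V" "\<And>y z. y \<in> Ch \<Longrightarrow> z \<in> Ch \<Longrightarrow> (y, z) \<in> r \<or> (z, y) \<in> r"
      using that unfolding Chains_def by blast+
    then obtain l where l: "l \<in> U" "\<forall>c\<in>Ch. (l, c) \<in> r" using chain[of Ch] False by blast
    then have "l \<in> ?V" using False Ch(1) tr by blast
    then show ?thesis unfolding FR using l Ch(1) by blast
  qed
  ultimately have "\<exists>m\<in>Field ?R. \<forall>y\<in>Field ?R. (m, y) \<in> ?R \<longrightarrow> y = m"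
    by (rule Zorns_po_lemma)
  then obtain m where m: "m \<in> ?V" "\<forall>y\<in>?V. (m, y) \<in> ?R \<longrightarrow> y = m"
    unfolding FR by blast
  then show ?thesis using tr by blast
qed

lemma K_or_W_retract_if_not_compact:
  assumes alg: "algebraic_domain r" and least: "is_least r lo" and greatest: "is_greatest r hi"
    and a: "a \<in> compact_elements r" and b: "b \<in> compact_elements r"
    and ncpt: "\<not> compactin (scott_topology r) (up r {a} \<inter> up r {b})"
  shows "has_K_or_W_retract TYPE('a) (r :: 'a rel)"
proof -
  note po = algebraic_domain_Partial_order[OF alg]
  have dcpo: "dcpo r" using alg by (simp add: algebraic_domain_def)
  let ?U = "up r {a} \<inter> up r {b}"
  have oU: "scott_open r ?U" using scott_open_up[OF po] a b by (intro scott_open_Int) auto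
  have UF: "?U \<subseteq> Field r" using up_subset_Field[of r] by blast
  have aF: "a \<in> Field r" "b \<in> Field r" using a b by (simp_all add: compact_elements_Field)
  \<comment> \<open>For comparable \<open>a\<close> and \<open>b\<close> the intersection is a
    principal filter, which is compact.\<close>
  have ab: "(a, b) \<notin> r" "(b, a) \<notin> r"
  proof -
    have "?U = up r {b}" if "(a, b) \<in> r"
      using that Partial_order_trans[OF po] by (auto simp: up_def)
    moreover have "?U = up r {a}" if "(b, a) \<in> r"
      using that Partial_order_trans[OF po] by (auto simp: up_def)
    ultimately show "(a, b) \<notin> r" "(b, a) \<notin> r"
      using ncpt compactin_up_singleton[OF po] aF by metis+
  qed
  show ?thesis
  proof (cases "\<exists>Ch\<subseteq>?U. Ch \<noteq> {} \<and> (\<forall>x\<in>Ch. \<forall>y\<in>Ch. (x, y) \<in> r \<or> (y, x) \<in> r) \<and>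
      \<not> (\<exists>l\<in>?U. \<forall>c\<in>Ch. (l, c) \<in> r)")
    case True
    then obtain Ch where Ch: "Ch \<subseteq> ?U" "Ch \<noteq> {}"
      and tot: "\<And>x y. x \<in> Ch \<Longrightarrow> y \<in> Ch \<Longrightarrow> (x, y) \<in> r \<or> (y, x) \<in> r"
      and nolb: "\<not> (\<exists>l\<in>?U. \<forall>c\<in>Ch. (l, c) \<in> r)"
      by blast
    have ChF: "Ch \<subseteq> Field r" using Ch UF by blast
    obtain C where C: "C \<subseteq> Ch"
      "\<And>S. S \<subseteq> C \<Longrightarrow> S \<noteq> {} \<Longrightarrow> \<exists>g\<in>S. \<forall>x\<in>S. (x, g) \<in> r"
      "\<And>x. x \<in> Ch \<Longrightarrow> \<exists>c\<in>C. (c, x) \<in> r"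
      using dually_well_ordered_coinitial[OF po ChF tot] by blast
    have CU: "C \<subseteq> ?U" using C(1) Ch(1) by blast
    \<comment> \<open>As \<open>C\<close> is coinitial in \<open>Ch\<close>, a lower bound of
      \<open>C\<close> would bound \<open>Ch\<close> as well.\<close>
    have nolbC: "\<exists>c\<in>C. (x, c) \<notin> r" if "x \<in> ?U" for x
      using that nolb C(3) Partial_order_trans[OF po] by blast
    have "C \<noteq> {}" using C(3) Ch(2) by blast
    moreover have "C \<subseteq> Field (Restr r C)"
      using CU UF Partial_order_refl[OF po] by (blast intro: FieldI1)
    ultimately have "Field (Restr r C) \<noteq> {}" by blast
    then show ?thesis
      using K_bot_retract[OF dcpo least a b ab CU C(2) nolbC]
      unfolding has_K_or_W_retract_def by blast
  next
    case False
    define E where "E = {e \<in> ?U. \<forall>y\<in>?U. (y, e) \<in> r \<longrightarrow> y = e}"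
    have above: "\<exists>e\<in>E. (e, x) \<in> r" if "x \<in> ?U" for x
      using exists_minimal_below[OF po UF that] False unfolding E_def by blast
    have EU: "E \<subseteq> ?U" by (auto simp: E_def)
    \<comment> \<open>The open set \<open>?U\<close> contains a compact element below each minimal
      one, and minimality identifies the two.\<close>
    have Ec: "E \<subseteq> compact_elements r"
      using compact_in_open_below[OF alg oU] unfolding E_def by blast
    \<comment> \<open>Otherwise \<open>?U\<close> would be a finite union of principal filters,
      hence compact.\<close>
    have "infinite E"
    proof
      assume "finite E"
      then have "compactin (scott_topology r) (\<Union>((\<lambda>e. up r {e}) ` E))"
        using EU UF compactin_up_singleton[OF po] by (intro compactin_Union) auto
      moreover have "\<Union>((\<lambda>e. up r {e}) ` E) = ?U"
      proof
        show "?U \<subseteq> \<Union>((\<lambda>e. up r {e}) ` E)" using above by (fastforce simp: up_def)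
        show "\<Union>((\<lambda>e. up r {e}) ` E) \<subseteq> ?U"
        proof (rule UN_least)
          fix e assume "e \<in> E"
          then have "e \<in> ?U" using EU by blast
          then show "up r {e} \<subseteq> ?U"
            using scott_open_upper[OF oU, of e] unfolding up_def[of r "{e}"] by blast
        qed
      qed
      ultimately show False using ncpt by simp
    qed
    moreover have "e = e'" if "e \<in> E" "e' \<in> E" "(e, e') \<in> r" for e e'
      using that by (auto simp: E_def)
    moreover have "Field (Id_on E) = E" by (auto simp: Field_def)
    ultimately show ?thesis
      using W_bot_top_retract[OF dcpo least greatest a b ab EU _ Ec _ above]
      unfolding has_K_or_W_retract_def by metis
  qed
qed

text \<open>The chain or anti-chain found for a non-coherent \<open>L\<close> consists of elements
  of \<open>L\<close>, so carriers in \<open>'a\<close> suffice for the equivalence. The second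
  conjunct gives the converse for carriers in an arbitrary type \<open>'c\<close>.\<close>

theorem theorem3p4:
  fixes L :: "'a rel" and bot top :: 'a
  assumes "algebraic_domain L"
    and "is_least L bot"
    and "is_greatest L top"
  shows "(\<not> coherent_dcpo L \<longleftrightarrow> has_K_or_W_retract TYPE('a) L) \<and>
         (has_K_or_W_retract TYPE('c) L \<longrightarrow> \<not> coherent_dcpo L)"
proof -
  have "has_K_or_W_retract TYPE('a) L" if "\<not> coherent_dcpo L"
    using that coherent_dcpo_if_compact_up_Int[OF assms(1)] K_or_W_retract_if_not_compact[OF assms]
    by blast
  moreover have "\<not> coherent_dcpo L" if "has_K_or_W_retract TYPE('a) L"
    using that not_coherent_if_K_bot_retract not_coherent_if_W_bot_top_retract
    unfolding has_K_or_W_retract_def by blast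
  moreover have "\<not> coherent_dcpo L" if "has_K_or_W_retract TYPE('c) L"
    using that not_coherent_if_K_bot_retract not_coherent_if_W_bot_top_retract
    unfolding has_K_or_W_retract_def by blast
  ultimately show ?thesis by blast
qed

end
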